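(* Let $m\ge1$, let $W\in C^2(\mathbb{R}^m,\mathbb{R})$ be a non-negative potential, and let $u\in C^2(\mathbb{R}^2,\mathbb{R}^m)$ be a solution of $\Delta u=\nabla W(u)$ in $\mathbb{R}^2$ satisfying $$\left(|u_{x_1}|^2-|u_{x_2}|^2\right)^2+4(u_{x_1}\cdot u_{x_2})^2\leq4(W(u))^2\quad\text{at every point of }\mathbb{R}^2.$$ Then, for every $x\in\mathbb{R}^2$, the function $$r\mapsto\frac1r\int_{B(x,r)}W(u(y))\,\mathrm{d}y$$ is an increasing function of $r>0$. In particular, if $m=1$, then this monotonicity formula holds for every bounded solution $u\in C^3(\mathbb{R}^2,\mathbb{R})$ of $\Delta u=W'(u)$.
   Context: $B(x,r)\subset\mathbb{R}^2$ denotes the ball centered at $x$ of radius $r$; $u_{x_i}=\partial u/\partial x_i\in\mathbb{R}^m$. "Increasing" is meant in the weak sense (non-decreasing). *)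

theory Defs
  imports "HOL-Analysis.Analysis"
begin

definition partial_deriv ::
  "'a::euclidean_space \<Rightarrow> ('a \<Rightarrow> 'b::real_normed_vector) \<Rightarrow> 'a \<Rightarrow> 'b"
  where "partial_deriv e f x = vector_derivative (\<lambda>t. f (x + t *\<^sub>R e)) (at 0)"

text \<open>Membership in \<open>C\<^sup>k\<close> on the whole space. Since \<^const>\<open>vector_derivative\<close> is an
  unspecified value where the derivative does not exist, differentiability is required
  separately at each order.\<close>

primrec Ck :: "nat \<Rightarrow> ('a::euclidean_space \<Rightarrow> 'b::real_normed_vector) \<Rightarrow> bool"
  where
    "Ck 0 f \<longleftrightarrow> continuous_on UNIV f"
  | "Ck (Suc k) f \<longleftrightarrow>
       (\<forall>x. f differentiable (at x)) \<and> (\<forall>e\<in>Basis. Ck k (partial_deriv e f))"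

definition laplacian ::
  "('a::euclidean_space \<Rightarrow> 'b::real_normed_vector) \<Rightarrow> 'a \<Rightarrow> 'b"
  where "laplacian f x = (\<Sum>e\<in>Basis. partial_deriv e (partial_deriv e f) x)"

abbreviation partial_1 :: "(real^2 \<Rightarrow> 'b::real_normed_vector) \<Rightarrow> real^2 \<Rightarrow> 'b"
  where "partial_1 \<equiv> partial_deriv (axis 1 1)"

abbreviation partial_2 :: "(real^2 \<Rightarrow> 'b::real_normed_vector) \<Rightarrow> real^2 \<Rightarrow> 'b"
  where "partial_2 \<equiv> partial_deriv (axis 2 1)"

end

theory Submission
  imports Defs
begin

text \<open>The stress tensor \<open>T\<close> of a solution is divergence free and has trace \<open>-2 W(u)\<close>, and the
  pointwise hypothesis says that \<open>T\<close> is negative semidefinite. Formally, integrating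
  \<open>div (T (y - x)) = tr T\<close> over a ball gives \<open>\<integral> W(u) \<le> r \<integral> W(u)\<close>, the ball on the left and its
  boundary circle on the right, which is the derivative form of the claim. To avoid
  boundary integrals, \<open>div T = 0\<close> is instead tested against the Lipschitz field
  \<open>y / max r \<bar>y\<bar> - y / max s \<bar>y\<bar>\<close>, which compares the radii \<open>r < s\<close> directly.

  In the scalar case the pointwise hypothesis is Modica's estimate \<open>\<bar>\<nabla>u\<bar>\<^sup>2 \<le> 2 W(u)\<close>. It needs no
  compactness of translates: a bound on \<open>\<nabla>u\<close> comes from Bernstein's method, and then
  \<open>\<bar>\<nabla>u\<bar>\<^sup>2 / 2 - W(u)\<close>, perturbed to a strict subsolution, is maximised after subtracting a small
  multiple of \<open>\<bar>x\<bar>\<^sup>2\<close>.\<close>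

section \<open>Directional derivatives\<close>

definition has_dir_deriv ::
  "('a::real_normed_vector \<Rightarrow> 'b::real_normed_vector) \<Rightarrow> ('a \<Rightarrow> 'b) \<Rightarrow> 'a \<Rightarrow> bool"
  where "has_dir_deriv f f' e \<longleftrightarrow>
    (\<forall>x. ((\<lambda>t. f (x + t *\<^sub>R e)) has_vector_derivative f' x) (at 0))"

lemma has_dir_deriv_line:
  assumes "has_dir_deriv f f' e"
  shows "((\<lambda>t. f (x + t *\<^sub>R e)) has_vector_derivative f' (x + s *\<^sub>R e)) (at s)"
proof -
  have "((\<lambda>t. f ((x + s *\<^sub>R e) + t *\<^sub>R e)) has_vector_derivative f' (x + s *\<^sub>R e)) (at (s + (-s)))"
    using assms by (simp add: has_dir_deriv_def)
  then have "((\<lambda>t. f ((x + s *\<^sub>R e) + t *\<^sub>R e)) \<circ> (\<lambda>t. t + (-s)) has_vector_derivative 1 *\<^sub>R f' (x + s *\<^sub>R e)) (at s)"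
    by (intro vector_diff_chain_at) (auto intro!: derivative_eq_intros)
  then show ?thesis
    by (simp add: o_def algebra_simps)
qed

lemma has_dir_deriv_line_real:
  fixes f :: "'a::real_normed_vector \<Rightarrow> real"
  assumes "has_dir_deriv f f' e"
  shows "((\<lambda>t. f (x + t *\<^sub>R e)) has_real_derivative f' (x + s *\<^sub>R e)) (at s)"
  using has_dir_deriv_line[OF assms] by (simp add: has_real_derivative_iff_has_vector_derivative)

lemma has_dir_deriv_realI:
  fixes f :: "'a::real_normed_vector \<Rightarrow> real"
  assumes "\<And>x. ((\<lambda>t. f (x + t *\<^sub>R e)) has_real_derivative f' x) (at 0)"
  shows "has_dir_deriv f f' e"
  using assms by (simp add: has_dir_deriv_def has_real_derivative_iff_has_vector_derivative)

lemma has_dir_deriv_partial_deriv: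
  assumes "\<And>x. f differentiable (at x)"
  shows "has_dir_deriv f (partial_deriv e f) e"
  unfolding has_dir_deriv_def
proof
  fix x
  have "(\<lambda>t. f (x + t *\<^sub>R e)) differentiable (at 0)"
    using differentiable_chain_at[of "\<lambda>t. x + t *\<^sub>R e" 0 f] assms by (simp add: o_def)
  then show "((\<lambda>t. f (x + t *\<^sub>R e)) has_vector_derivative partial_deriv e f x) (at 0)"
    unfolding partial_deriv_def by (simp add: vector_derivative_works)
qed

lemma has_dir_deriv_const: "has_dir_deriv (\<lambda>x. c) (\<lambda>x. 0) e"
  by (simp add: has_dir_deriv_def)

lemma has_dir_deriv_add:
  assumes "has_dir_deriv f f' e" "has_dir_deriv g g' e"
  shows "has_dir_deriv (\<lambda>x. f x + g x) (\<lambda>x. f' x + g' x) e"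
  using assms by (auto simp: has_dir_deriv_def intro: has_vector_derivative_add)

lemma has_dir_deriv_diff:
  assumes "has_dir_deriv f f' e" "has_dir_deriv g g' e"
  shows "has_dir_deriv (\<lambda>x. f x - g x) (\<lambda>x. f' x - g' x) e"
  using assms by (auto simp: has_dir_deriv_def intro: has_vector_derivative_diff)

lemma has_dir_deriv_inner:
  fixes f g :: "'a::real_normed_vector \<Rightarrow> 'b::real_inner"
  assumes "has_dir_deriv f f' e" "has_dir_deriv g g' e"
  shows "has_dir_deriv (\<lambda>x. f x \<bullet> g x) (\<lambda>x. f' x \<bullet> g x + f x \<bullet> g' x) e"
proof -
  have "((\<lambda>t. f (x + t *\<^sub>R e) \<bullet> g (x + t *\<^sub>R e)) has_vector_derivative f' x \<bullet> g x + f x \<bullet> g' x) (at 0)" for x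
    using assms unfolding has_dir_deriv_def has_vector_derivative_def
    by (auto intro!: derivative_eq_intros ext dest!: spec[of _ x] simp: algebra_simps)
  then show ?thesis by (simp add: has_dir_deriv_def)
qed

lemma has_dir_deriv_mult:
  fixes f g :: "'a::real_normed_vector \<Rightarrow> real"
  assumes "has_dir_deriv f f' e" "has_dir_deriv g g' e"
  shows "has_dir_deriv (\<lambda>x. f x * g x) (\<lambda>x. f' x * g x + f x * g' x) e"
  using has_dir_deriv_inner[OF assms] by simp

lemma has_dir_deriv_inner_left:
  fixes c :: "'a::real_inner"
  shows "has_dir_deriv (\<lambda>x. (x - a) \<bullet> c) (\<lambda>x. e \<bullet> c) e"
  by (intro has_dir_deriv_realI)
     (auto intro!: derivative_eq_intros simp: inner_add_left inner_diff_left)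

lemma has_dir_deriv_compose:
  fixes u :: "'a::real_normed_vector \<Rightarrow> 'b::real_inner"
  assumes "has_dir_deriv u u' e" and "\<And>x. GDERIV W (u x) :> g x"
  shows "has_dir_deriv (\<lambda>x. W (u x)) (\<lambda>x. u' x \<bullet> g x) e"
proof -
  have "((\<lambda>t. W (u (x + t *\<^sub>R e))) has_vector_derivative u' x \<bullet> g x) (at 0)" for x
  proof -
    have "((\<lambda>t. u (x + t *\<^sub>R e)) has_derivative (\<lambda>h. h *\<^sub>R u' x)) (at 0)"
      using assms(1) by (simp add: has_dir_deriv_def has_vector_derivative_def)
    moreover have "(W has_derivative (\<lambda>h. h \<bullet> g x)) (at (u (x + 0 *\<^sub>R e)))"
      using assms(2) by (simp add: gderiv_def)
    ultimately have "((\<lambda>t. W (u (x + t *\<^sub>R e))) has_derivative (\<lambda>h. (h *\<^sub>R u' x) \<bullet> g x)) (at 0)"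
      by (rule has_derivative_compose)
    then show ?thesis by (simp add: has_vector_derivative_def)
  qed
  then show ?thesis by (simp add: has_dir_deriv_def)
qed

lemma has_dir_deriv_compose_real:
  fixes u :: "'a::real_normed_vector \<Rightarrow> real"
  assumes "has_dir_deriv u u' e" and "\<And>y. (W has_real_derivative W' y) (at y)"
  shows "has_dir_deriv (\<lambda>x. W (u x)) (\<lambda>x. W' (u x) * u' x) e"
  using has_dir_deriv_compose[OF assms(1), of W "\<lambda>x. W' (u x)"] assms(2)
  by (simp add: mult.commute)

lemma second_difference:
  fixes f :: "'a::real_normed_vector \<Rightarrow> real"
  assumes f1: "has_dir_deriv f f1 e1" and f12: "has_dir_deriv f1 f12 e2" and "h > 0"
  obtains s t where "0 < s" "s < h" "0 < t" "t < h"
    "f (x + h *\<^sub>R e1 + h *\<^sub>R e2) - f (x + h *\<^sub>R e1) - f (x + h *\<^sub>R e2) + f x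
      = h\<^sup>2 * f12 (x + s *\<^sub>R e1 + t *\<^sub>R e2)"
proof -
  define g where "g s = f ((x + h *\<^sub>R e2) + s *\<^sub>R e1) - f (x + s *\<^sub>R e1)" for s
  have "\<exists>s. 0 < s \<and> s < h \<and> g h - g 0
      = (h - 0) * (f1 ((x + h *\<^sub>R e2) + s *\<^sub>R e1) - f1 (x + s *\<^sub>R e1))"
    unfolding g_def using \<open>h > 0\<close>
    by (intro MVT2 DERIV_diff has_dir_deriv_line_real f1)
  then obtain s where s: "0 < s" "s < h"
    "g h - g 0 = h * (f1 ((x + h *\<^sub>R e2) + s *\<^sub>R e1) - f1 (x + s *\<^sub>R e1))" by auto
  define k where "k t = f1 ((x + s *\<^sub>R e1) + t *\<^sub>R e2)" for t
  have "\<exists>t. 0 < t \<and> t < h \<and> k h - k 0 = (h - 0) * f12 ((x + s *\<^sub>R e1) + t *\<^sub>R e2)"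
    unfolding k_def using \<open>h > 0\<close> by (intro MVT2 has_dir_deriv_line_real f12)
  then obtain t where t: "0 < t" "t < h" "k h - k 0 = h * f12 (x + s *\<^sub>R e1 + t *\<^sub>R e2)"
    by auto
  have "g h - g 0 = h * (k h - k 0)"
    using s(3) by (simp add: k_def add_ac)
  then have "g h - g 0 = h\<^sup>2 * f12 (x + s *\<^sub>R e1 + t *\<^sub>R e2)"
    by (simp add: t(3) power2_eq_square)
  then show thesis
    using s(1,2) t(1,2) that by (simp add: g_def add_ac)
qed

lemma mixed_partials_eq_real:
  fixes f :: "'a::real_normed_vector \<Rightarrow> real"
  assumes f1: "has_dir_deriv f f1 e1" and f12: "has_dir_deriv f1 f12 e2"
    and f2: "has_dir_deriv f f2 e2" and f21: "has_dir_deriv f2 f21 e1"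
    and cont: "isCont f12 x" "isCont f21 x"
  shows "f12 x = f21 x"
proof -
  have "\<bar>f12 x - f21 x\<bar> \<le> \<epsilon>" if "\<epsilon> > 0" for \<epsilon>
  proof -
    obtain d where d: "d > 0" "\<And>y. dist y x < d \<Longrightarrow> dist (f12 y) (f12 x) < \<epsilon> / 2"
      "\<And>y. dist y x < d \<Longrightarrow> dist (f21 y) (f21 x) < \<epsilon> / 2"
    proof -
      have "\<epsilon> / 2 > 0" using \<open>\<epsilon> > 0\<close> by simp
      then obtain d1 where "d1 > 0" "\<And>y. dist y x < d1 \<Longrightarrow> dist (f12 y) (f12 x) < \<epsilon> / 2"
        using cont(1) unfolding continuous_at_eps_delta by blast
      moreover obtain d2 where "d2 > 0" "\<And>y. dist y x < d2 \<Longrightarrow> dist (f21 y) (f21 x) < \<epsilon> / 2"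
        using cont(2) \<open>\<epsilon> / 2 > 0\<close> unfolding continuous_at_eps_delta by blast
      ultimately show thesis
        using that[of "min d1 d2"] by simp
    qed
    define h where "h = d / (1 + norm e1 + norm e2)"
    have den: "1 + norm e1 + norm e2 > 0"
      by (smt (verit) norm_ge_zero)
    have h: "h > 0" "h * (1 + norm e1 + norm e2) = d"
      using \<open>d > 0\<close> den by (auto simp: h_def)
    have near: "dist (x + s *\<^sub>R e1 + t *\<^sub>R e2) x < d" if "0 < s" "s < h" "0 < t" "t < h" for s t
    proof -
      have "dist (x + s *\<^sub>R e1 + t *\<^sub>R e2) x \<le> s * norm e1 + t * norm e2"
        using norm_triangle_ineq[of "s *\<^sub>R e1" "t *\<^sub>R e2"] that by (simp add: dist_norm algebra_simps)
      also have "\<dots> \<le> h * norm e1 + h * norm e2"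
        using that by (intro add_mono mult_right_mono) auto
      also have "\<dots> < d"
        using h by (simp add: algebra_simps)
      finally show ?thesis .
    qed
    obtain s t where st: "0 < s" "s < h" "0 < t" "t < h"
      "f (x + h *\<^sub>R e1 + h *\<^sub>R e2) - f (x + h *\<^sub>R e1) - f (x + h *\<^sub>R e2) + f x
        = h\<^sup>2 * f12 (x + s *\<^sub>R e1 + t *\<^sub>R e2)"
      using second_difference[OF f1 f12 \<open>h > 0\<close>] by blast
    obtain s' t' where st': "0 < s'" "s' < h" "0 < t'" "t' < h"
      "f (x + h *\<^sub>R e2 + h *\<^sub>R e1) - f (x + h *\<^sub>R e2) - f (x + h *\<^sub>R e1) + f x
        = h\<^sup>2 * f21 (x + s' *\<^sub>R e2 + t' *\<^sub>R e1)"
      using second_difference[OF f2 f21 \<open>h > 0\<close>] by blast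
    have "h\<^sup>2 * f12 (x + s *\<^sub>R e1 + t *\<^sub>R e2) = h\<^sup>2 * f21 (x + t' *\<^sub>R e1 + s' *\<^sub>R e2)"
      using st(5) st'(5) by (simp add: algebra_simps)
    then have "f12 (x + s *\<^sub>R e1 + t *\<^sub>R e2) = f21 (x + t' *\<^sub>R e1 + s' *\<^sub>R e2)"
      using \<open>h > 0\<close> by simp
    then show ?thesis
      using d(2)[OF near[OF st(1-4)]] d(3)[OF near[OF st'(3,4,1,2)]]
      unfolding dist_real_def by linarith
  qed
  then have "\<bar>f12 x - f21 x\<bar> \<le> 0"
    by (rule field_le_epsilon) simp
  then show ?thesis by simp
qed

lemma has_dir_deriv_inner_const:
  fixes f :: "'a::real_normed_vector \<Rightarrow> 'b::real_inner"
  assumes "has_dir_deriv f f' e"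
  shows "has_dir_deriv (\<lambda>x. f x \<bullet> b) (\<lambda>x. f' x \<bullet> b) e"
  using has_dir_deriv_inner[OF assms has_dir_deriv_const[of b]] by simp

lemma mixed_partials_eq:
  fixes f :: "'a::real_normed_vector \<Rightarrow> 'b::real_inner"
  assumes "has_dir_deriv f f1 e1" "has_dir_deriv f1 f12 e2"
    and "has_dir_deriv f f2 e2" "has_dir_deriv f2 f21 e1"
    and "isCont f12 x" "isCont f21 x"
  shows "f12 x = f21 x"
proof -
  have "f12 x \<bullet> b = f21 x \<bullet> b" for b
    using assms
    by (intro mixed_partials_eq_real[where f = "\<lambda>x. f x \<bullet> b" and ?f1.0 = "\<lambda>x. f1 x \<bullet> b" and ?e1.0 = e1
          and ?e2.0 = e2 and ?f2.0 = "\<lambda>x. f2 x \<bullet> b" and ?f12.0 = "\<lambda>x. f12 x \<bullet> b" and ?f21.0 = "\<lambda>x. f21 x \<bullet> b"]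
        has_dir_deriv_inner_const continuous_intros)
  then show ?thesis
    by (metis vector_eq_rdot)
qed

lemma second_derivative_nonpos_at_local_max:
  fixes g :: "real \<Rightarrow> real"
  assumes "d > 0" and max: "\<And>t. \<bar>t\<bar> < d \<Longrightarrow> g t \<le> g 0"
    and g': "\<And>t. (g has_real_derivative g' t) (at t)"
    and g'': "(g' has_real_derivative g'') (at 0)"
  shows "g' 0 = 0" "g'' \<le> 0"
proof -
  show *: "g' 0 = 0"
    using DERIV_local_max[OF g'[of 0] \<open>d > 0\<close>] max by simp
  show "g'' \<le> 0"
  proof (rule ccontr)
    assume "\<not> g'' \<le> 0"
    then obtain d' where d': "d' > 0" "\<And>h. 0 < h \<Longrightarrow> h < d' \<Longrightarrow> g' 0 < g' (0 + h)"
      using DERIV_pos_inc_right[OF g''] by force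
    define h where "h = min d d' / 2"
    have h: "0 < h" "h < d" "h < d'" using \<open>d > 0\<close> d'(1) by (auto simp: h_def min_def)
    obtain z where "0 < z" "z < h" "g h - g 0 = (h - 0) * g' z"
      using MVT2[OF h(1), of g g'] g' by blast
    moreover have "h * g' z > 0"
      using d'(2)[of z] h * \<open>0 < z\<close> \<open>z < h\<close> by simp
    ultimately show False using max[of h] h by simp
  qed
qed

lemma has_dir_deriv_local_max:
  fixes f :: "'a::real_normed_vector \<Rightarrow> real"
  assumes f': "has_dir_deriv f f' e" and f'': "has_dir_deriv f' f'' e"
    and "r > 0" and max: "\<And>y. y \<in> ball x r \<Longrightarrow> f y \<le> f x"
  shows "f' x = 0" "f'' x \<le> 0"
proof -
  define d where "d = r / (1 + norm e)"
  have den: "1 + norm e > 0" by (smt (verit) norm_ge_zero)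
  have d: "d > 0" "d * (1 + norm e) = r" using \<open>r > 0\<close> den by (auto simp: d_def)
  have "f (x + t *\<^sub>R e) \<le> f (x + 0 *\<^sub>R e)" if "\<bar>t\<bar> < d" for t
  proof -
    have "\<bar>t\<bar> * norm e \<le> d * norm e" using that by (intro mult_right_mono) auto
    also have "\<dots> < r" using d by (simp add: algebra_simps)
    finally show ?thesis by (simp add: max dist_norm)
  qed
  note * = second_derivative_nonpos_at_local_max[OF d(1) this
      has_dir_deriv_line_real[OF f'] has_dir_deriv_line_real[OF f'']]
  show "f' x = 0" "f'' x \<le> 0" using * by simp_all
qed

section \<open>Integration by parts against Lipschitz functions\<close>

lemma integral_lborel_translate:
  fixes f :: "'a::euclidean_space \<Rightarrow> real"
  assumes "f \<in> borel_measurable borel"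
  shows "(LINT x|lborel. f (x + v)) = (LINT x|lborel. f x)"
    and "integrable lborel (\<lambda>x. f (x + v)) \<longleftrightarrow> integrable lborel f"
proof -
  have "(LINT x|lborel. f x) = (LINT x|distr lborel borel ((+) v). f x)"
    by (simp add: lborel_distr_plus)
  also have "\<dots> = (LINT x|lborel. f (v + x))"
    using assms by (intro integral_distr) auto
  finally show "(LINT x|lborel. f (x + v)) = (LINT x|lborel. f x)"
    by (simp add: add.commute)
  have "integrable lborel f \<longleftrightarrow> integrable (distr lborel borel ((+) v)) f"
    by (simp add: lborel_distr_plus)
  also have "\<dots> \<longleftrightarrow> integrable lborel (\<lambda>x. f (v + x))"
    using assms by (intro integrable_distr_eq) auto
  finally show "integrable lborel (\<lambda>x. f (x + v)) \<longleftrightarrow> integrable lborel f"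
    by (simp add: add.commute)
qed

lemma integrable_continuous_compact_support:
  fixes f :: "'a::euclidean_space \<Rightarrow> real"
  assumes "continuous_on UNIV f" "compact S" "\<And>x. x \<notin> S \<Longrightarrow> f x = 0"
  shows "integrable lborel f"
proof -
  have "integrable lborel (\<lambda>x. indicator S x *\<^sub>R f x)"
    using assms(1,2) by (intro borel_integrable_compact) (auto intro: continuous_on_subset)
  also have "(\<lambda>x. indicator S x *\<^sub>R f x) = f"
    using assms(3) by (auto simp: fun_eq_iff indicator_def)
  finally show ?thesis .
qed

text \<open>Translation invariance makes every difference quotient integrate to zero, and the Lipschitz
  bound allows passing to the limit by dominated convergence.\<close>

lemma integral_dir_deriv_eq_0:
  fixes f :: "'a::euclidean_space \<Rightarrow> real"
  assumes cont: "continuous_on UNIV f"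
    and supp: "\<And>x. x \<notin> cball c R \<Longrightarrow> f x = 0"
    and lip: "\<And>x h. 0 < h \<Longrightarrow> h \<le> 1 \<Longrightarrow> \<bar>f (x + h *\<^sub>R e) - f x\<bar> \<le> C * h"
    and der: "AE x in lborel. ((\<lambda>t. f (x + t *\<^sub>R e)) has_real_derivative f' x) (at 0)"
    and meas: "f' \<in> borel_measurable borel"
  shows "integrable lborel f'" and "(LINT x|lborel. f' x) = 0"
proof -
  define h where "h n = 1 / real (Suc n)" for n
  define s where "s n x = (f (x + h n *\<^sub>R e) - f x) / h n" for n x
  define w where "w x = indicator (cball c (R + norm e)) x *\<^sub>R C" for x
  have h: "0 < h n" "h n \<le> 1" for n by (auto simp: h_def)
  have h0: "filterlim h (at 0) sequentially"
    unfolding h_def filterlim_at using LIMSEQ_inverse_real_of_nat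
    by (auto simp: inverse_eq_divide)
  have fm: "f \<in> borel_measurable borel"
    using cont by (rule borel_measurable_continuous_onI)
  have fi: "integrable lborel f"
    using cont supp by (intro integrable_continuous_compact_support[of f "cball c R"]) auto
  have fi': "integrable lborel (\<lambda>x. f (x + h n *\<^sub>R e))" for n
    using fi integral_lborel_translate(2)[OF fm] by simp
  have s0: "(LINT x|lborel. s n x) = 0" for n
    using fi fi' integral_lborel_translate(1)[OF fm, of "h n *\<^sub>R e"] by (simp add: s_def)
  have sm: "s n \<in> borel_measurable lborel" for n
    using borel_measurable_integrable[OF fi] borel_measurable_integrable[OF fi']
    unfolding s_def by measurable
  have "integrable lborel w"
    unfolding w_def by (rule borel_integrable_compact) auto
  moreover have "norm (s n x) \<le> w x" for n x
  proof (cases "x \<in> cball c (R + norm e)")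
    case True
    have "\<bar>s n x\<bar> = \<bar>f (x + h n *\<^sub>R e) - f x\<bar> / h n"
      using h[of n] by (simp add: s_def)
    also have "\<dots> \<le> C"
      using lip[OF h] h[of n] by (simp add: divide_le_eq)
    finally show ?thesis using True by (simp add: w_def)
  next
    case False
    have "h n * norm e \<le> 1 * norm e"
      using h[of n] by (intro mult_right_mono) auto
    then have "dist c x \<le> dist c (x + h n *\<^sub>R e) + norm e"
      using dist_triangle[of c x "x + h n *\<^sub>R e"] h[of n] by (simp add: dist_norm)
    then have "x + h n *\<^sub>R e \<notin> cball c R" using False by auto
    moreover have "x \<notin> cball c R" using False by (auto intro: order_trans)
    ultimately show ?thesis using False supp by (simp add: s_def w_def)
  qed
  moreover have "AE x in lborel. (\<lambda>n. s n x) \<longlonglongrightarrow> f' x"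
    using der
  proof eventually_elim
    case (elim x)
    then have "((\<lambda>t. (f (x + t *\<^sub>R e) - f x) / t) \<longlongrightarrow> f' x) (at 0)"
      by (simp add: DERIV_def)
    then show ?case unfolding s_def using h0 by (rule filterlim_compose)
  qed
  ultimately have "integrable lborel f'" "(\<lambda>n. LINT x|lborel. s n x) \<longlonglongrightarrow> (LINT x|lborel. f' x)"
    using meas sm
    by (auto intro!: integrable_dominated_convergence[where s = s and w = w]
        integral_dominated_convergence[where s = s and w = w])
  then show "integrable lborel f'" "(LINT x|lborel. f' x) = 0"
    by (auto simp: s0 LIMSEQ_const_iff)
qed

lemma has_dir_deriv_increment_bound:
  fixes f :: "'a::real_normed_vector \<Rightarrow> real"
  assumes f': "has_dir_deriv f f' e" and "0 < h"
    and bound: "\<And>t. 0 < t \<Longrightarrow> t < h \<Longrightarrow> \<bar>f' (x + t *\<^sub>R e)\<bar> \<le> B"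
  shows "\<bar>f (x + h *\<^sub>R e) - f x\<bar> \<le> B * h"
proof -
  have "\<exists>t. 0 < t \<and> t < h \<and> f (x + h *\<^sub>R e) - f (x + 0 *\<^sub>R e) = (h - 0) * f' (x + t *\<^sub>R e)"
    using \<open>0 < h\<close> by (intro MVT2 has_dir_deriv_line_real f')
  then show ?thesis
    using bound \<open>0 < h\<close> by (auto simp: abs_mult mult.commute)
qed

lemma integral_by_parts_lipschitz:
  fixes a \<psi> :: "'a::euclidean_space \<Rightarrow> real"
  assumes a': "has_dir_deriv a a' e"
    and cont: "continuous_on UNIV a" "continuous_on UNIV a'"
    and lip: "L-lipschitz_on UNIV \<psi>"
    and supp: "\<And>x. x \<notin> cball c R \<Longrightarrow> \<psi> x = 0"
    and der: "AE x in lborel. ((\<lambda>t. \<psi> (x + t *\<^sub>R e)) has_real_derivative \<psi>' x) (at 0)"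
    and meas: "\<psi>' \<in> borel_measurable borel"
  shows "integrable lborel (\<lambda>x. a' x * \<psi> x + a x * \<psi>' x)"
    and "(LINT x|lborel. a' x * \<psi> x + a x * \<psi>' x) = 0"
proof -
  define K where "K = cball c (R + 2 * norm e)"
  have bdd: "\<exists>B\<ge>0. \<forall>x\<in>K. \<bar>g x\<bar> \<le> B" if "continuous_on UNIV g" for g :: "'a \<Rightarrow> real"
  proof -
    have "compact (g ` K)"
      using that unfolding K_def by (intro compact_continuous_image) (auto intro: continuous_on_subset)
    then obtain B where "\<forall>x\<in>K. \<bar>g x\<bar> \<le> B"
      using compact_imp_bounded by (fastforce simp: bounded_iff)
    then show ?thesis by (intro exI[of _ "max 0 B"]) auto
  qed
  have contp: "continuous_on UNIV \<psi>"
    using lip by (rule lipschitz_on_continuous_on)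
  obtain A where A: "A \<ge> 0" "\<And>x. x \<in> K \<Longrightarrow> \<bar>a x\<bar> \<le> A" using bdd[OF cont(1)] by blast
  obtain A' where A': "A' \<ge> 0" "\<And>x. x \<in> K \<Longrightarrow> \<bar>a' x\<bar> \<le> A'" using bdd[OF cont(2)] by blast
  obtain P where P: "P \<ge> 0" "\<And>x. x \<in> K \<Longrightarrow> \<bar>\<psi> x\<bar> \<le> P" using bdd[OF contp] by blast
  define C where "C = A * L * norm e + P * A'"
  have "L \<ge> 0" using lip by (rule lipschitz_on_nonneg)
  have "\<bar>a (x + h *\<^sub>R e) * \<psi> (x + h *\<^sub>R e) - a x * \<psi> x\<bar> \<le> C * h" if "0 < h" "h \<le> 1" for x h
  proof (cases "x \<in> cball c (R + norm e)")
    case True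
    have seg: "x + t *\<^sub>R e \<in> K" if "0 \<le> t" "t \<le> h" for t
    proof -
      have "t * norm e \<le> 1 * norm e"
        using that \<open>h \<le> 1\<close> by (intro mult_right_mono) auto
      then show ?thesis
        using True dist_triangle[of c "x + t *\<^sub>R e" x] that by (simp add: K_def dist_norm)
    qed
    have "\<bar>a (x + h *\<^sub>R e) - a x\<bar> \<le> A' * h"
      using seg by (intro has_dir_deriv_increment_bound[OF a' \<open>0 < h\<close>] A'(2)) auto
    moreover have "\<bar>\<psi> (x + h *\<^sub>R e) - \<psi> x\<bar> \<le> L * (norm e * h)"
      using lipschitz_onD[OF lip, of "x + h *\<^sub>R e" x] \<open>0 < h\<close> by (simp add: dist_norm mult.commute)
    moreover have "\<bar>a (x + h *\<^sub>R e)\<bar> \<le> A" "\<bar>\<psi> x\<bar> \<le> P"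
      using A(2)[OF seg[of h]] P(2)[OF seg[of 0]] \<open>0 < h\<close> by auto
    ultimately have "\<bar>a (x + h *\<^sub>R e)\<bar> * \<bar>\<psi> (x + h *\<^sub>R e) - \<psi> x\<bar> + \<bar>\<psi> x\<bar> * \<bar>a (x + h *\<^sub>R e) - a x\<bar>
        \<le> A * (L * (norm e * h)) + P * (A' * h)"
      using A(1) P(1) by (intro add_mono mult_mono) auto
    moreover have "\<bar>a (x + h *\<^sub>R e) * \<psi> (x + h *\<^sub>R e) - a x * \<psi> x\<bar>
        \<le> \<bar>a (x + h *\<^sub>R e)\<bar> * \<bar>\<psi> (x + h *\<^sub>R e) - \<psi> x\<bar> + \<bar>\<psi> x\<bar> * \<bar>a (x + h *\<^sub>R e) - a x\<bar>"
    proof -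
      have "a (x + h *\<^sub>R e) * \<psi> (x + h *\<^sub>R e) - a x * \<psi> x
          = a (x + h *\<^sub>R e) * (\<psi> (x + h *\<^sub>R e) - \<psi> x) + \<psi> x * (a (x + h *\<^sub>R e) - a x)"
        by (simp add: algebra_simps)
      then show ?thesis
        by (simp only: abs_mult[symmetric] abs_triangle_ineq)
    qed
    ultimately have "\<bar>a (x + h *\<^sub>R e) * \<psi> (x + h *\<^sub>R e) - a x * \<psi> x\<bar>
        \<le> A * (L * (norm e * h)) + P * (A' * h)" by (rule order_trans[rotated])
    then show ?thesis by (simp add: C_def algebra_simps)
  next
    case False
    have "h * norm e \<le> 1 * norm e"
      using that by (intro mult_right_mono) auto
    then have "dist c x \<le> dist c (x + h *\<^sub>R e) + norm e"
      using dist_triangle[of c x "x + h *\<^sub>R e"] that by (simp add: dist_norm)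
    then have "x + h *\<^sub>R e \<notin> cball c R" using False by auto
    moreover have "x \<notin> cball c R" using False by (auto intro: order_trans)
    moreover have "C \<ge> 0" using A A' P \<open>L \<ge> 0\<close> by (simp add: C_def)
    ultimately show ?thesis using supp that by simp
  qed
  moreover have "AE x in lborel. ((\<lambda>t. a (x + t *\<^sub>R e) * \<psi> (x + t *\<^sub>R e)) has_real_derivative
      a' x * \<psi> x + a x * \<psi>' x) (at 0)"
    using der
  proof eventually_elim
    case (elim x)
    have "((\<lambda>t. a (x + t *\<^sub>R e)) has_real_derivative a' x) (at 0)"
      using has_dir_deriv_line_real[OF a', of x 0] by simp
    from DERIV_mult[OF this elim] show ?case by (simp add: algebra_simps)
  qed
  moreover have "(\<lambda>x. a' x * \<psi> x + a x * \<psi>' x) \<in> borel_measurable borel"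
    using cont[THEN borel_measurable_continuous_onI] contp[THEN borel_measurable_continuous_onI] meas
    by measurable
  moreover have "continuous_on UNIV (\<lambda>x. a x * \<psi> x)"
    using cont contp by (intro continuous_intros)
  moreover have "a x * \<psi> x = 0" if "x \<notin> cball c R" for x
    using supp[OF that] by simp
  ultimately show "integrable lborel (\<lambda>x. a' x * \<psi> x + a x * \<psi>' x)"
    "(LINT x|lborel. a' x * \<psi> x + a x * \<psi>' x) = 0"
    using integral_dir_deriv_eq_0[of "\<lambda>x. a x * \<psi> x" c R e C "\<lambda>x. a' x * \<psi> x + a x * \<psi>' x"]
    by blast+
qed

section \<open>Divergence-free tensors in the plane\<close>

definition trunc_radial :: "real \<Rightarrow> 'a::real_inner \<Rightarrow> 'a \<Rightarrow> 'a"
  where "trunc_radial r c x = (1 / max r (norm (x - c))) *\<^sub>R (x - c)"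

definition trunc_radial_deriv :: "real \<Rightarrow> 'a::real_inner \<Rightarrow> 'a \<Rightarrow> 'a \<Rightarrow> 'a \<Rightarrow> real"
  where "trunc_radial_deriv r c e d x =
    (if norm (x - c) < r then (e \<bullet> d) / r
     else (e \<bullet> d) / norm (x - c) - ((x - c) \<bullet> e) * ((x - c) \<bullet> d) / norm (x - c) ^ 3)"

lemma trunc_radial_lipschitz:
  fixes c :: "'a::real_inner"
  assumes "r > 0"
  shows "(2 / r)-lipschitz_on UNIV (trunc_radial r c)"
proof (rule lipschitz_onI)
  fix x y :: 'a
  define a where "a = x - c"
  define b where "b = y - c"
  define p where "p = max r (norm a)"
  define q where "q = max r (norm b)"
  have pq: "p > 0" "q > 0" "r \<le> p" "norm b \<le> q"
    using \<open>r > 0\<close> by (auto simp: p_def q_def)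
  have "\<bar>q - p\<bar> \<le> \<bar>norm a - norm b\<bar>"
    by (auto simp: p_def q_def max_def)
  also have "\<dots> \<le> norm (a - b)" by (rule norm_triangle_ineq3)
  finally have qp: "\<bar>q - p\<bar> \<le> norm (a - b)" .
  have "(1 / p) *\<^sub>R a - (1 / q) *\<^sub>R b = (1 / p) *\<^sub>R (a - b) + ((q - p) / (p * q)) *\<^sub>R b"
  proof -
    have "(q - p) / (p * q) = 1 / p - 1 / q" using pq by (simp add: field_simps)
    then have "((q - p) / (p * q)) *\<^sub>R b = (1 / p) *\<^sub>R b - (1 / q) *\<^sub>R b"
      by (simp only: scaleR_left_diff_distrib)
    then show ?thesis by (simp add: scaleR_right_diff_distrib)
  qed
  then have "norm ((1 / p) *\<^sub>R a - (1 / q) *\<^sub>R b) \<le> norm (a - b) / p + \<bar>q - p\<bar> / p * (norm b / q)"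
    using norm_triangle_ineq[of "(1 / p) *\<^sub>R (a - b)" "((q - p) / (p * q)) *\<^sub>R b"] pq by simp
  also have "\<dots> \<le> norm (a - b) / p + norm (a - b) / p * 1"
    using pq qp by (intro add_mono mult_mono divide_right_mono) auto
  also have "\<dots> \<le> norm (a - b) / r + norm (a - b) / r"
    using pq \<open>r > 0\<close> by (simp add: divide_left_mono add_mono)
  finally show "dist (trunc_radial r c x) (trunc_radial r c y) \<le> 2 / r * dist x y"
    by (simp add: trunc_radial_def dist_norm a_def b_def p_def q_def)
qed (use \<open>r > 0\<close> in auto)

lemma trunc_radial_has_deriv:
  fixes c :: "'a::real_inner"
  assumes "r > 0" "norm (x - c) \<noteq> r"
  shows "((\<lambda>t. trunc_radial r c (x + t *\<^sub>R e) \<bullet> d) has_real_derivative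
      trunc_radial_deriv r c e d x) (at 0)"
proof -
  define y where "y = x - c"
  have shift: "x + t *\<^sub>R e - c = y + t *\<^sub>R e" for t by (simp add: y_def)
  have cont: "((\<lambda>t. norm (y + t *\<^sub>R e)) \<longlongrightarrow> norm y) (nhds 0)"
  proof -
    have "isCont (\<lambda>t. norm (y + t *\<^sub>R e)) 0" by (intro continuous_intros)
    then show ?thesis by (simp add: tendsto_nhds_iff isCont_def)
  qed
  show ?thesis
  proof (cases "norm y < r")
    case True
    have "\<forall>\<^sub>F t in nhds 0. norm (y + t *\<^sub>R e) < r"
      using order_tendstoD(2)[OF cont True] .
    then have "\<forall>\<^sub>F t in nhds 0. trunc_radial r c (x + t *\<^sub>R e) \<bullet> d = ((y + t *\<^sub>R e) \<bullet> d) / r"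
      by eventually_elim (simp add: trunc_radial_def shift)
    moreover have "((\<lambda>t. ((y + t *\<^sub>R e) \<bullet> d) / r) has_real_derivative (e \<bullet> d) / r) (at 0)"
      using \<open>r > 0\<close> by (auto intro!: derivative_eq_intros simp: inner_add_left)
    ultimately show ?thesis
      using True by (subst DERIV_cong_ev[OF refl _ refl]) (auto simp: trunc_radial_deriv_def y_def)
  next
    case False
    then have "norm y > r" using assms(2) by (simp add: y_def)
    then have "y \<noteq> 0" using \<open>r > 0\<close> by auto
    have "\<forall>\<^sub>F t in nhds 0. norm (y + t *\<^sub>R e) > r"
      using order_tendstoD(1)[OF cont \<open>norm y > r\<close>] .
    then have "\<forall>\<^sub>F t in nhds 0. trunc_radial r c (x + t *\<^sub>R e) \<bullet> d
        = ((y + t *\<^sub>R e) \<bullet> d) / sqrt ((y + t *\<^sub>R e) \<bullet> (y + t *\<^sub>R e))"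
      by eventually_elim (simp add: trunc_radial_def shift norm_eq_sqrt_inner)
    moreover have "((\<lambda>t. ((y + t *\<^sub>R e) \<bullet> d) / sqrt ((y + t *\<^sub>R e) \<bullet> (y + t *\<^sub>R e)))
        has_real_derivative (e \<bullet> d) / norm y - (y \<bullet> e) * (y \<bullet> d) / norm y ^ 3) (at 0)"
    proof -
      have sq: "sqrt (y \<bullet> y) = norm y" by (simp add: norm_eq_sqrt_inner)
      have "((\<lambda>t. (y + t *\<^sub>R e) \<bullet> (y + t *\<^sub>R e)) has_real_derivative 2 * (y \<bullet> e)) (at 0)"
        by (auto intro!: derivative_eq_intros simp: inner_add_left inner_add_right inner_commute)
      moreover have "(sqrt has_real_derivative inverse (norm y) / 2) (at ((y + 0 *\<^sub>R e) \<bullet> (y + 0 *\<^sub>R e)))"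
        using DERIV_real_sqrt[of "y \<bullet> y"] \<open>y \<noteq> 0\<close> by (simp add: sq)
      ultimately have "((\<lambda>t. sqrt ((y + t *\<^sub>R e) \<bullet> (y + t *\<^sub>R e))) has_real_derivative
          inverse (norm y) / 2 * (2 * (y \<bullet> e))) (at 0)"
        by (rule DERIV_chain2[where f = sqrt, rotated])
      moreover have "((\<lambda>t. (y + t *\<^sub>R e) \<bullet> d) has_real_derivative e \<bullet> d) (at 0)"
        by (auto intro!: derivative_eq_intros simp: inner_add_left)
      ultimately have "((\<lambda>t. ((y + t *\<^sub>R e) \<bullet> d) / sqrt ((y + t *\<^sub>R e) \<bullet> (y + t *\<^sub>R e))) has_real_derivative
          ((e \<bullet> d) * norm y - (y \<bullet> d) * (inverse (norm y) / 2 * (2 * (y \<bullet> e)))) / (norm y * norm y)) (at 0)"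
        using DERIV_divide[of "\<lambda>t. (y + t *\<^sub>R e) \<bullet> d" "e \<bullet> d" 0 UNIV
            "\<lambda>t. sqrt ((y + t *\<^sub>R e) \<bullet> (y + t *\<^sub>R e))"] \<open>y \<noteq> 0\<close>
        by (simp add: sq)
      also have "((e \<bullet> d) * norm y - (y \<bullet> d) * (inverse (norm y) / 2 * (2 * (y \<bullet> e)))) / (norm y * norm y)
          = (e \<bullet> d) / norm y - (y \<bullet> e) * (y \<bullet> d) / norm y ^ 3"
        using \<open>y \<noteq> 0\<close> by (simp add: field_simps power3_eq_cube)
      finally show ?thesis .
    qed
    ultimately show ?thesis
      using False by (subst DERIV_cong_ev[OF refl _ refl]) (auto simp: trunc_radial_deriv_def y_def)
  qed
qed

lemma Basis_real_2: "Basis = {axis 1 1, axis 2 (1::real) :: real^2}"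
  by (auto simp: Basis_vec_def UNIV_2)

lemma sum_Basis_real_2:
  fixes f :: "real^2 \<Rightarrow> 'b::comm_monoid_add"
  shows "(\<Sum>e\<in>Basis. f e) = f (axis 1 1) + f (axis 2 1)"
  by (simp add: Basis_real_2 axis_eq_axis)

text \<open>Testing the equation \<open>div T = 0\<close> against the field \<open>trunc_radial r c - trunc_radial s c\<close>,
  which is supported in the ball of radius \<open>s\<close>, yields the difference of the two normalised
  integrals up to a term whose sign is that of \<open>T\<close>.\<close>

lemma divergence_free_tensor_monotonicity:
  fixes T11 T12 T22 A1 A2 B1 B2 :: "real^2 \<Rightarrow> real" and c :: "real^2"
  assumes cont: "continuous_on UNIV T11" "continuous_on UNIV T12" "continuous_on UNIV T22"
    "continuous_on UNIV A1" "continuous_on UNIV A2" "continuous_on UNIV B1" "continuous_on UNIV B2"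
    and A: "has_dir_deriv T11 A1 (axis 1 1)" "has_dir_deriv T12 A2 (axis 2 1)" "\<And>x. A1 x + A2 x = 0"
    and B: "has_dir_deriv T12 B1 (axis 1 1)" "has_dir_deriv T22 B2 (axis 2 1)" "\<And>x. B1 x + B2 x = 0"
    and nonpos: "\<And>x a b. T11 x * a\<^sup>2 + 2 * T12 x * a * b + T22 x * b\<^sup>2 \<le> 0"
  shows "mono_on {0<..} (\<lambda>r. (1 / r) * (LINT x:ball c r|lborel. - (T11 x + T22 x)))"
proof (rule mono_onI)
  fix r s :: real
  assume "r \<in> {0<..}" "s \<in> {0<..}" "r \<le> s"
  then have rs: "0 < r" "0 < s" "r \<le> s" by auto
  define \<psi> where "\<psi> d x = (trunc_radial r c x - trunc_radial s c x) \<bullet> d" for d x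
  define \<psi>' where "\<psi>' e d x = trunc_radial_deriv r c e d x - trunc_radial_deriv s c e d x" for e d x
  have lip: "((2 / r + 2 / s) * norm d)-lipschitz_on UNIV (\<psi> d)" for d
  proof (rule lipschitz_onI)
    fix x y :: "real^2"
    have "(2 / r + 2 / s)-lipschitz_on UNIV (\<lambda>x. trunc_radial r c x - trunc_radial s c x)"
      using rs by (intro lipschitz_on_diff trunc_radial_lipschitz)
    then have "norm (trunc_radial r c x - trunc_radial s c x - (trunc_radial r c y - trunc_radial s c y))
        \<le> (2 / r + 2 / s) * dist x y"
      using lipschitz_onD[of _ UNIV _ x y] by (fastforce simp: dist_norm)
    then have "norm (trunc_radial r c x - trunc_radial s c x - (trunc_radial r c y - trunc_radial s c y)) * norm d
        \<le> (2 / r + 2 / s) * dist x y * norm d"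
      by (rule mult_right_mono) simp
    then have "\<bar>(trunc_radial r c x - trunc_radial s c x - (trunc_radial r c y - trunc_radial s c y)) \<bullet> d\<bar>
        \<le> (2 / r + 2 / s) * dist x y * norm d"
      by (rule order_trans[OF Cauchy_Schwarz_ineq2])
    then show "dist (\<psi> d x) (\<psi> d y) \<le> (2 / r + 2 / s) * norm d * dist x y"
      by (simp add: \<psi>_def dist_real_def inner_diff_left ac_simps)
  qed (use rs in simp)
  have supp: "\<psi> d x = 0" if "x \<notin> cball c s" for d x
    using that rs by (simp add: \<psi>_def trunc_radial_def dist_norm norm_minus_commute)
  have null: "sphere c k \<in> null_sets lborel" for k
    using negligible_sphere[of c k]
    by (auto simp: null_sets_completion_iff negligible_iff_null_sets negligible_convex_frontier)
  have der: "AE x in lborel. ((\<lambda>t. \<psi> d (x + t *\<^sub>R e)) has_real_derivative \<psi>' e d x) (at 0)" for d e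
    using AE_not_in[OF null[of r]] AE_not_in[OF null[of s]]
  proof eventually_elim
    case (elim x)
    then have "norm (x - c) \<noteq> r" "norm (x - c) \<noteq> s"
      by (auto simp: dist_norm norm_minus_commute)
    then show ?case
      unfolding \<psi>_def \<psi>'_def inner_diff_left
      using rs by (intro DERIV_diff trunc_radial_has_deriv)
  qed
  have meas: "\<psi>' e d \<in> borel_measurable borel" for e d
    unfolding \<psi>'_def trunc_radial_deriv_def by measurable
  let ?e1 = "axis 1 1 :: real^2" and ?e2 = "axis 2 1 :: real^2"
  have ibp: "integrable lborel (\<lambda>x. a' x * \<psi> d x + a x * \<psi>' e d x)"
    "(LINT x|lborel. a' x * \<psi> d x + a x * \<psi>' e d x) = 0"
    if "has_dir_deriv a a' e" "continuous_on UNIV a" "continuous_on UNIV a'" for a a' e d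
    using integral_by_parts_lipschitz[OF that lip _ der meas, of c s] supp by blast+
  note I = ibp[OF A(1) cont(1,4), of ?e1] ibp[OF A(2) cont(2,5), of ?e1]
    ibp[OF B(1) cont(2,6), of ?e2] ibp[OF B(2) cont(3,7), of ?e2]
  define G where "G x = (A1 x * \<psi> ?e1 x + T11 x * \<psi>' ?e1 ?e1 x) + (A2 x * \<psi> ?e1 x + T12 x * \<psi>' ?e2 ?e1 x)
    + ((B1 x * \<psi> ?e2 x + T12 x * \<psi>' ?e1 ?e2 x) + (B2 x * \<psi> ?e2 x + T22 x * \<psi>' ?e2 ?e2 x))" for x
  have G: "integrable lborel G" "(LINT x|lborel. G x) = 0"
    unfolding G_def using I by simp_all
  define t where "t x = T11 x + T22 x" for x
  define H where "H k x = indicator (ball c k) x *\<^sub>R t x" for k x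
  have ct: "continuous_on UNIV t"
    unfolding t_def using cont by (intro continuous_intros)
  have H: "integrable lborel (H k)" for k
  proof (rule Bochner_Integration.integrable_bound)
    show "integrable lborel (\<lambda>x. indicator (cball c k) x *\<^sub>R t x)"
      using ct by (intro borel_integrable_compact) (auto intro: continuous_on_subset)
    show "H k \<in> borel_measurable lborel"
      unfolding H_def using borel_measurable_continuous_onI[OF ct]
      by (intro borel_measurable_scaleR borel_measurable_indicator) auto
    show "AE x in lborel. norm (H k x) \<le> norm (indicator (cball c k) x *\<^sub>R t x)"
      by (auto simp: H_def indicator_def)
  qed
  have "G x \<le> H r x / r - H s x / s" for x
  proof -
    define n where "n = norm (x - c)"
    define y1 where "y1 = (x - c) $ 1"
    define y2 where "y2 = (x - c) $ 2"
    define q where "q = T11 x * y1\<^sup>2 + 2 * T12 x * y1 * y2 + T22 x * y2\<^sup>2"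
    define S where "S k = (if n < k then t x / k else t x / n - q / n ^ 3)" for k
    have n2: "n\<^sup>2 = y1\<^sup>2 + y2\<^sup>2"
      by (simp add: n_def y1_def y2_def norm_vec_def L2_set_def sum_2)
    have "t x * n\<^sup>2 - q = T11 x * y2\<^sup>2 + 2 * T12 x * y2 * (- y1) + T22 x * (- y1)\<^sup>2"
      by (simp add: n2 t_def q_def algebra_simps)
    then have tq: "t x * n\<^sup>2 \<le> q"
      using nonpos[of x y2 "- y1"] by linarith
    have inn: "?e1 \<bullet> ?e1 = 1" "?e1 \<bullet> ?e2 = 0" "?e2 \<bullet> ?e1 = 0" "?e2 \<bullet> ?e2 = 1"
      "(x - c) \<bullet> ?e1 = y1" "(x - c) \<bullet> ?e2 = y2"
      by (simp_all add: inner_axis y1_def y2_def) (simp_all add: axis_def)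
    have D: "trunc_radial_deriv k c ?e1 ?e1 x = (if n < k then 1 / k else 1 / n - y1 * y1 / n ^ 3)"
      "trunc_radial_deriv k c ?e2 ?e1 x = (if n < k then 0 else - y1 * y2 / n ^ 3)"
      "trunc_radial_deriv k c ?e1 ?e2 x = (if n < k then 0 else - y1 * y2 / n ^ 3)"
      "trunc_radial_deriv k c ?e2 ?e2 x = (if n < k then 1 / k else 1 / n - y2 * y2 / n ^ 3)" for k
      by (simp_all add: trunc_radial_deriv_def inn n_def)
    have S: "T11 x * trunc_radial_deriv k c ?e1 ?e1 x + T12 x * trunc_radial_deriv k c ?e2 ?e1 x
        + T12 x * trunc_radial_deriv k c ?e1 ?e2 x + T22 x * trunc_radial_deriv k c ?e2 ?e2 x = S k" for k
      unfolding D S_def t_def q_def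
      by (simp add: add_divide_distrib algebra_simps power2_eq_square)
    have "G x = (A1 x + A2 x) * \<psi> ?e1 x + (B1 x + B2 x) * \<psi> ?e2 x + (S r - S s)"
      unfolding G_def \<psi>'_def S[symmetric] by (simp add: algebra_simps)
    then have "G x = S r - S s" by (simp add: A(3) B(3))
    also have "\<dots> \<le> H r x / r - H s x / s"
    proof -
      have ind: "H k x = (if n < k then t x else 0)" for k
        by (simp add: H_def n_def indicator_def dist_norm norm_minus_commute)
      have "t x / n - q / n ^ 3 \<le> 0" if "\<not> n < r"
      proof -
        have "n > 0" using that rs by simp
        then have "t x / n - q / n ^ 3 = (t x * n\<^sup>2 - q) / n ^ 3"
          by (simp add: field_simps power2_eq_square power3_eq_cube)
        then show ?thesis using tq \<open>n > 0\<close> by (simp add: divide_nonpos_pos)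
      qed
      then show ?thesis using rs by (auto simp: S_def ind)
    qed
    finally show ?thesis .
  qed
  then have "(LINT x|lborel. G x) \<le> (LINT x|lborel. H r x / r - H s x / s)"
    using G(1) H by (intro integral_mono) auto
  also have "\<dots> = (LINT x|lborel. H r x) / r - (LINT x|lborel. H s x) / s"
    using H by simp
  finally have "(LINT x|lborel. H s x) / s \<le> (LINT x|lborel. H r x) / r"
    using G(2) by simp
  moreover have "(LINT x:ball c k|lborel. - (T11 x + T22 x)) = - (LINT x|lborel. H k x)" for k
  proof -
    have "(LINT x:ball c k|lborel. - (T11 x + T22 x)) = (LINT x|lborel. - H k x)"
      unfolding set_lebesgue_integral_def H_def t_def by (simp only: scaleR_minus_right)
    then show ?thesis by simp
  qed
  ultimately show "(1 / r) * (LINT x:ball c r|lborel. - (T11 x + T22 x))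
      \<le> (1 / s) * (LINT x:ball c s|lborel. - (T11 x + T22 x))"
    by simp
qed

lemma Ck_has_dir_deriv: "Ck (Suc k) f \<Longrightarrow> has_dir_deriv f (partial_deriv e f) e"
  by (simp add: has_dir_deriv_partial_deriv)

lemma Ck_Suc_imp_continuous: "Ck (Suc k) f \<Longrightarrow> continuous_on UNIV f"
  by (simp add: continuous_at_imp_continuous_on differentiable_imp_continuous_within)

lemma Ck_partial_deriv: "Ck (Suc k) f \<Longrightarrow> e \<in> Basis \<Longrightarrow> Ck k (partial_deriv e f)"
  by simp

lemma Ck_Suc_imp: "Ck (Suc k) f \<Longrightarrow> Ck k f"
  by (induction k arbitrary: f) (simp_all add: Ck_Suc_imp_continuous[of 0, simplified])

lemma Ck_imp_continuous: "Ck k f \<Longrightarrow> continuous_on UNIV f"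
  by (cases k) (auto simp del: Ck.simps(2) dest: Ck_Suc_imp_continuous)

lemma Ck_mixed_partials:
  fixes f :: "'a::euclidean_space \<Rightarrow> 'b::real_inner"
  assumes "Ck (Suc (Suc k)) f" "e \<in> Basis" "d \<in> Basis"
  shows "partial_deriv e (partial_deriv d f) x = partial_deriv d (partial_deriv e f) x"
proof -
  have c: "isCont (partial_deriv a (partial_deriv b f)) x" if "a \<in> Basis" "b \<in> Basis" for a b
    using Ck_imp_continuous[OF Ck_partial_deriv[OF Ck_partial_deriv[OF assms(1) that(2)] that(1)]]
    by (simp add: continuous_on_eq_continuous_at)
  show ?thesis
    using assms Ck_partial_deriv[OF assms(1)]
    by (intro mixed_partials_eq[of f "partial_deriv d f" d _ e "partial_deriv e f"] c Ck_has_dir_deriv)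
qed

lemma laplacian_real_2:
  "laplacian u (x :: real^2) = partial_1 (partial_1 u) x + partial_2 (partial_2 u) x"
  by (simp add: laplacian_def sum_Basis_real_2)

lemma axis_Basis: "axis i 1 \<in> (Basis :: (real^'n) set)"
  by (simp add: axis_in_Basis_iff)

text \<open>The tensor in the proof has components
  \<open>u\<^sub>i \<bullet> u\<^sub>j - \<delta>\<^sub>i\<^sub>j (\<bar>\<nabla>u\<bar>\<^sup>2 / 2 + W(u))\<close>.\<close>

lemma stress_tensor_monotonicity:
  fixes W :: "'b::euclidean_space \<Rightarrow> real" and u :: "real^2 \<Rightarrow> 'b"
  assumes W: "\<And>p. W p \<ge> 0" and u: "Ck 2 u"
    and grad: "\<And>x. GDERIV W (u x) :> laplacian u x"
    and bound: "\<And>x. ((norm (partial_1 u x))\<^sup>2 - (norm (partial_2 u x))\<^sup>2)\<^sup>2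
      + 4 * (partial_1 u x \<bullet> partial_2 u x)\<^sup>2 \<le> 4 * (W (u x))\<^sup>2"
  shows "mono_on {0<..} (\<lambda>r. (1 / r) * (LINT y:ball c r|lborel. W (u y)))"
proof -
  define u1 where "u1 = partial_1 u"
  define u2 where "u2 = partial_2 u"
  define u11 where "u11 = partial_1 u1"
  define u12 where "u12 = partial_2 u1"
  define u21 where "u21 = partial_1 u2"
  define u22 where "u22 = partial_2 u2"
  note defs = u1_def u2_def u11_def u12_def u21_def u22_def
  have C2: "Ck (Suc (Suc 0)) u" using u by (simp add: numeral_2_eq_2)
  have C1: "Ck (Suc 0) u1" "Ck (Suc 0) u2"
    unfolding defs by (rule Ck_partial_deriv[OF C2 axis_Basis])+
  have C0: "Ck 0 u11" "Ck 0 u12" "Ck 0 u21" "Ck 0 u22"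
    unfolding u11_def u12_def u21_def u22_def by (rule C1[THEN Ck_partial_deriv, OF axis_Basis])+
  have cont: "continuous_on UNIV u1" "continuous_on UNIV u2" "continuous_on UNIV u11"
    "continuous_on UNIV u12" "continuous_on UNIV u21" "continuous_on UNIV u22"
    using C1 C0 Ck_imp_continuous by blast+
  have d: "has_dir_deriv u u1 (axis 1 1)" "has_dir_deriv u u2 (axis 2 1)"
    "has_dir_deriv u1 u11 (axis 1 1)" "has_dir_deriv u1 u12 (axis 2 1)"
    "has_dir_deriv u2 u21 (axis 1 1)" "has_dir_deriv u2 u22 (axis 2 1)"
    using C2 C1 Ck_has_dir_deriv unfolding defs by blast+
  have sym: "u21 x = u12 x" for x
    unfolding defs by (rule Ck_mixed_partials[OF C2 axis_Basis axis_Basis])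
  have grad': "GDERIV W (u x) :> u11 x + u22 x" for x
    using grad[of x] by (simp add: laplacian_real_2 defs)
  have dW: "has_dir_deriv (\<lambda>x. W (u x)) (\<lambda>x. u1 x \<bullet> (u11 x + u22 x)) (axis 1 1)"
    "has_dir_deriv (\<lambda>x. W (u x)) (\<lambda>x. u2 x \<bullet> (u11 x + u22 x)) (axis 2 1)"
    using d(1,2) grad' by (auto intro: has_dir_deriv_compose)
  have cW: "continuous_on UNIV (\<lambda>x. W (u x))"
  proof -
    have "isCont (\<lambda>x. W (u x)) x" for x
    proof (rule isCont_o2[where f = u and g = W])
      show "isCont u x"
        using Ck_imp_continuous[OF C2] by (simp add: continuous_on_eq_continuous_at)
      show "isCont W (u x)"
        using grad[of x] unfolding gderiv_def by (rule has_derivative_continuous)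
    qed
    then show ?thesis by (simp add: continuous_at_imp_continuous_on)
  qed
  define h :: "real^2 \<Rightarrow> real" where "h x = 1 / 2" for x
  have h: "has_dir_deriv h (\<lambda>x. 0) e" for e
    unfolding h_def by (rule has_dir_deriv_const)
  let ?T11 = "\<lambda>y. h y * (u1 y \<bullet> u1 y - u2 y \<bullet> u2 y) - W (u y)"
  let ?T12 = "\<lambda>y. u1 y \<bullet> u2 y"
  let ?T22 = "\<lambda>y. h y * (u2 y \<bullet> u2 y - u1 y \<bullet> u1 y) - W (u y)"
  let ?A1 = "\<lambda>x. (0 * (u1 x \<bullet> u1 x - u2 x \<bullet> u2 x) + h x * ((u11 x \<bullet> u1 x + u1 x \<bullet> u11 x)
        - (u21 x \<bullet> u2 x + u2 x \<bullet> u21 x))) - u1 x \<bullet> (u11 x + u22 x)"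
  let ?A2 = "\<lambda>x. u12 x \<bullet> u2 x + u1 x \<bullet> u22 x"
  let ?B1 = "\<lambda>x. u11 x \<bullet> u2 x + u1 x \<bullet> u21 x"
  let ?B2 = "\<lambda>x. (0 * (u2 x \<bullet> u2 x - u1 x \<bullet> u1 x) + h x * ((u22 x \<bullet> u2 x + u2 x \<bullet> u22 x)
        - (u12 x \<bullet> u1 x + u1 x \<bullet> u12 x))) - u2 x \<bullet> (u11 x + u22 x)"
  have "mono_on {0<..} (\<lambda>r. (1 / r) * (LINT y:ball c r|lborel. - (?T11 y + ?T22 y)))"
  proof (rule divergence_free_tensor_monotonicity[where ?T12.0 = ?T12 and ?A1.0 = ?A1
        and ?A2.0 = ?A2 and ?B1.0 = ?B1 and ?B2.0 = ?B2])
    show "has_dir_deriv ?T11 ?A1 (axis 1 1)"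
      using d dW h by (intro has_dir_deriv_diff has_dir_deriv_mult has_dir_deriv_inner)
    show "has_dir_deriv ?T12 ?A2 (axis 2 1)" "has_dir_deriv ?T12 ?B1 (axis 1 1)"
      by (fact has_dir_deriv_inner[OF d(4,6)] has_dir_deriv_inner[OF d(3,5)])+
    show "has_dir_deriv ?T22 ?B2 (axis 2 1)"
      using d dW h by (intro has_dir_deriv_diff has_dir_deriv_mult has_dir_deriv_inner)
    show "?T11 x * a\<^sup>2 + 2 * ?T12 x * a * b + ?T22 x * b\<^sup>2 \<le> 0" for x a b
    proof -
      define m where "m = u1 x \<bullet> u1 x - u2 x \<bullet> u2 x"
      define k where "k = 2 * (u1 x \<bullet> u2 x)"
      define p where "p = (a\<^sup>2 - b\<^sup>2) / 2"
      define q where "q = a * b"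
      define N where "N = (a\<^sup>2 + b\<^sup>2) / 2"
      have mk: "m\<^sup>2 + k\<^sup>2 \<le> 4 * (W (u x))\<^sup>2"
        using bound[of x] by (simp add: m_def k_def defs power2_norm_eq_inner power_mult_distrib)
      have pq: "p\<^sup>2 + q\<^sup>2 = N\<^sup>2"
        by (simp add: p_def q_def N_def power2_eq_square field_simps)
      have "(m * p + k * q)\<^sup>2 = (m\<^sup>2 + k\<^sup>2) * (p\<^sup>2 + q\<^sup>2) - (m * q - k * p)\<^sup>2"
        by (simp add: power2_eq_square algebra_simps)
      also have "\<dots> \<le> (m\<^sup>2 + k\<^sup>2) * (p\<^sup>2 + q\<^sup>2)" by simp
      also have "\<dots> \<le> 4 * (W (u x))\<^sup>2 * N\<^sup>2"
        unfolding pq using mk by (rule mult_right_mono) simp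
      also have "\<dots> = (2 * W (u x) * N)\<^sup>2" by (simp add: power_mult_distrib)
      finally have "m * p + k * q \<le> 2 * W (u x) * N"
        by (rule power2_le_imp_le) (use W in \<open>simp add: N_def\<close>)
      then show ?thesis
        by (simp add: h_def m_def k_def p_def q_def N_def field_simps)
    qed
  qed (use cont cW in \<open>auto simp: h_def sym inner_commute algebra_simps intro!: continuous_intros\<close>)
  moreover have "(\<lambda>y. - (?T11 y + ?T22 y)) = (\<lambda>y. 2 * W (u y))"
    by (simp add: fun_eq_iff algebra_simps)
  ultimately have "mono_on {0<..} (\<lambda>r. (1 / r) * (LINT y:ball c r|lborel. 2 * W (u y)))"
    by (simp only:)
  then show ?thesis
    by (simp add: monotone_on_def times_divide_eq_right[symmetric] del: times_divide_eq_right)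
qed

section \<open>Gradient estimates for scalar solutions\<close>

lemma has_dir_deriv_cong:
  "has_dir_deriv f f' e \<Longrightarrow> (\<And>x. f' x = g' x) \<Longrightarrow> has_dir_deriv f g' e"
  by (simp add: has_dir_deriv_def)

lemmas has_dir_deriv_intros = has_dir_deriv_add has_dir_deriv_diff has_dir_deriv_mult has_dir_deriv_const

lemma cball_interior_max:
  fixes Z :: "'a::euclidean_space \<Rightarrow> real"
  assumes "R > 0" and cont: "continuous_on UNIV Z"
  obtains m where "m \<in> cball a R" "\<And>y. y \<in> cball a R \<Longrightarrow> Z y \<le> Z m"
    "dist a m \<noteq> R \<Longrightarrow> ball m (R - dist a m) \<subseteq> cball a R \<and> R - dist a m > 0"
proof -
  have "continuous_on (cball a R) Z" "cball a R \<noteq> {}"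
    using cont \<open>R > 0\<close> by (auto intro: continuous_on_subset)
  then obtain m where m: "m \<in> cball a R" "\<And>y. y \<in> cball a R \<Longrightarrow> Z y \<le> Z m"
    using continuous_attains_sup[of "cball a R" Z] by auto
  moreover have "ball m (R - dist a m) \<subseteq> cball a R" "dist a m \<noteq> R \<Longrightarrow> R - dist a m > 0"
    using m(1) by (auto simp: ball_subset_cball_iff dist_commute)
  ultimately show thesis using that by blast
qed

locale planar_scalar_solution =
  fixes u u1 u2 u11 u12 u22 u111 u112 u122 u222 :: "real^2 \<Rightarrow> real"
    and W f f' :: "real \<Rightarrow> real" and N F L :: real
  assumes d: "has_dir_deriv u u1 (axis 1 1)" "has_dir_deriv u u2 (axis 2 1)"
    "has_dir_deriv u1 u11 (axis 1 1)" "has_dir_deriv u1 u12 (axis 2 1)"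
    "has_dir_deriv u2 u12 (axis 1 1)" "has_dir_deriv u2 u22 (axis 2 1)"
    "has_dir_deriv u11 u111 (axis 1 1)" "has_dir_deriv u12 u112 (axis 1 1)"
    "has_dir_deriv u12 u122 (axis 2 1)" "has_dir_deriv u22 u222 (axis 2 1)"
    and cont: "continuous_on UNIV u" "continuous_on UNIV u1" "continuous_on UNIV u2"
    and dW: "\<And>y. (W has_real_derivative f y) (at y)"
    and df: "\<And>y. (f has_real_derivative f' y) (at y)"
    and eq: "\<And>x. u11 x + u22 x = f (u x)"
    and eq1: "\<And>x. u111 x + u122 x = f' (u x) * u1 x"
    and eq2: "\<And>x. u112 x + u222 x = f' (u x) * u2 x"
    and W_nonneg: "\<And>y. W y \<ge> 0"
    and bounds: "\<And>x. \<bar>u x\<bar> \<le> N" "\<And>x. \<bar>f (u x)\<bar> \<le> F" "\<And>x. \<bar>f' (u x)\<bar> \<le> L"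
begin

lemma bounds_nonneg: "0 \<le> N" "0 \<le> F" "0 \<le> L"
  using bounds[of 0] by linarith+

definition grad_sq :: "real^2 \<Rightarrow> real"
  where "grad_sq x = u1 x * u1 x + u2 x * u2 x"

definition hess_sq :: "real^2 \<Rightarrow> real"
  where "hess_sq x = u11 x * u11 x + 2 * (u12 x * u12 x) + u22 x * u22 x"

definition rel_coord :: "2 \<Rightarrow> real^2 \<Rightarrow> real^2 \<Rightarrow> real"
  where "rel_coord i a = (\<lambda>x. (x - a) \<bullet> axis i 1)"

lemma rel_coord_deriv:
  "has_dir_deriv (rel_coord 1 a) (\<lambda>x. 1) (axis 1 1)" "has_dir_deriv (rel_coord 1 a) (\<lambda>x. 0) (axis 2 1)"
  "has_dir_deriv (rel_coord 2 a) (\<lambda>x. 0) (axis 1 1)" "has_dir_deriv (rel_coord 2 a) (\<lambda>x. 1) (axis 2 1)"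
proof -
  have "has_dir_deriv (rel_coord i a) (\<lambda>x. axis j (1::real) \<bullet> axis i 1) (axis j 1)" for i j
    unfolding rel_coord_def by (rule has_dir_deriv_inner_left)
  from this[of 1 1] this[of 1 2] this[of 2 1] this[of 2 2]
  show "has_dir_deriv (rel_coord 1 a) (\<lambda>x. 1) (axis 1 1)" "has_dir_deriv (rel_coord 1 a) (\<lambda>x. 0) (axis 2 1)"
    "has_dir_deriv (rel_coord 2 a) (\<lambda>x. 0) (axis 1 1)" "has_dir_deriv (rel_coord 2 a) (\<lambda>x. 1) (axis 2 1)"
    by (simp_all add: inner_axis_axis)
qed

lemma rel_coord_cont: "continuous_on UNIV (rel_coord i a)"
  unfolding rel_coord_def by (intro continuous_intros)

lemma inner_self_real_2: "v \<bullet> v = v $ 1 * v $ 1 + v $ 2 * v $ 2" for v :: "real^2"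
  by (simp add: inner_vec_def sum_2)

lemma rel_coord_sq: "rel_coord 1 a x * rel_coord 1 a x + rel_coord 2 a x * rel_coord 2 a x = (dist a x)\<^sup>2"
  by (simp add: rel_coord_def dist_norm power2_norm_eq_inner inner_axis inner_self_real_2 algebra_simps)

lemma rel_coord_center: "rel_coord i a a = 0"
  by (simp add: rel_coord_def)

text \<open>Bernstein's method: at an interior maximum of \<open>\<eta>\<^sup>2 \<bar>\<nabla>u\<bar>\<^sup>2 + lam u\<^sup>2\<close> the Hessian terms
  produced by the cut-off \<open>\<eta>\<close> are absorbed by completing squares.\<close>

lemma gradient_bound: "grad_sq a \<le> (17 + L) * (N * F + N\<^sup>2)"
proof -
  define lam where "lam = 17 + L"
  define \<eta> where "\<eta> = (\<lambda>x. 1 - (rel_coord 1 a x * rel_coord 1 a x + rel_coord 2 a x * rel_coord 2 a x))"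
  define Z where "Z = (\<lambda>x. \<eta> x * \<eta> x * (u1 x * u1 x + u2 x * u2 x) + lam * (u x * u x))"
  define Z1 where "Z1 = (\<lambda>x. - 4 * (rel_coord 1 a x * (\<eta> x * (u1 x * u1 x + u2 x * u2 x)))
    + 2 * (\<eta> x * \<eta> x * (u1 x * u11 x + u2 x * u12 x)) + 2 * lam * (u x * u1 x))"
  define Z2 where "Z2 = (\<lambda>x. - 4 * (rel_coord 2 a x * (\<eta> x * (u1 x * u1 x + u2 x * u2 x)))
    + 2 * (\<eta> x * \<eta> x * (u1 x * u12 x + u2 x * u22 x)) + 2 * lam * (u x * u2 x))"
  define Z11 where "Z11 = (\<lambda>x. (8 * (rel_coord 1 a x * rel_coord 1 a x) - 4 * \<eta> x) * (u1 x * u1 x + u2 x * u2 x)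
    - 16 * (rel_coord 1 a x * \<eta> x * (u1 x * u11 x + u2 x * u12 x))
    + 2 * (\<eta> x * \<eta> x * (u11 x * u11 x + u1 x * u111 x + u12 x * u12 x + u2 x * u112 x))
    + 2 * lam * (u1 x * u1 x + u x * u11 x))"
  define Z22 where "Z22 = (\<lambda>x. (8 * (rel_coord 2 a x * rel_coord 2 a x) - 4 * \<eta> x) * (u1 x * u1 x + u2 x * u2 x)
    - 16 * (rel_coord 2 a x * \<eta> x * (u1 x * u12 x + u2 x * u22 x))
    + 2 * (\<eta> x * \<eta> x * (u12 x * u12 x + u1 x * u122 x + u22 x * u22 x + u2 x * u222 x))
    + 2 * lam * (u2 x * u2 x + u x * u22 x))"
  have \<eta>d: "has_dir_deriv \<eta> (\<lambda>x. - 2 * rel_coord 1 a x) (axis 1 1)" "has_dir_deriv \<eta> (\<lambda>x. - 2 * rel_coord 2 a x) (axis 2 1)"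
    unfolding \<eta>_def
    by (rule has_dir_deriv_cong, (rule has_dir_deriv_intros rel_coord_deriv)+, simp add: algebra_simps)+
  have Zd: "has_dir_deriv Z Z1 (axis 1 1)" "has_dir_deriv Z Z2 (axis 2 1)"
    unfolding Z_def Z1_def Z2_def
    by (rule has_dir_deriv_cong, (rule has_dir_deriv_intros \<eta>d d)+, simp add: algebra_simps)+
  have Zdd: "has_dir_deriv Z1 Z11 (axis 1 1)" "has_dir_deriv Z2 Z22 (axis 2 1)"
    unfolding Z1_def Z2_def Z11_def Z22_def
    by (rule has_dir_deriv_cong, (rule has_dir_deriv_intros \<eta>d d rel_coord_deriv)+, simp add: algebra_simps)+
  have "continuous_on UNIV Z"
    unfolding Z_def \<eta>_def by (intro continuous_intros cont rel_coord_cont)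
  then obtain m where m: "m \<in> cball a 1" "\<And>y. y \<in> cball a 1 \<Longrightarrow> Z y \<le> Z m"
    "dist a m \<noteq> 1 \<Longrightarrow> ball m (1 - dist a m) \<subseteq> cball a 1 \<and> 1 - dist a m > 0"
    using cball_interior_max[of 1 Z a] by (metis zero_less_one)
  have lam: "lam \<ge> 0" using bounds_nonneg by (simp add: lam_def)
  have uu: "u x * u x \<le> N\<^sup>2" for x
    using bounds(1)[of x] by (metis abs_le_square_iff abs_of_nonneg bounds_nonneg(1) power2_eq_square)
  have "Z m \<le> lam * (N * F + N\<^sup>2)"
  proof (cases "dist a m = 1")
    case True
    then have "Z m = lam * (u m * u m)" by (simp add: Z_def \<eta>_def rel_coord_sq)
    also have "\<dots> \<le> lam * (N * F + N\<^sup>2)"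
      using uu[of m] lam mult_nonneg_nonneg[OF bounds_nonneg(1,2)] by (intro mult_left_mono) auto
    finally show ?thesis .
  next
    case False
    have max: "Z y \<le> Z m" if "y \<in> ball m (1 - dist a m)" for y
      using m(2,3) False that by blast
    define \<rho> where "\<rho> = rel_coord 1 a m * rel_coord 1 a m + rel_coord 2 a m * rel_coord 2 a m"
    have \<rho>: "0 \<le> \<rho>" "\<rho> \<le> 1" "\<eta> m = 1 - \<rho>"
      using m(1) by (auto simp: \<rho>_def rel_coord_sq \<eta>_def abs_square_le_1)
    have "Z11 m \<le> 0" "Z22 m \<le> 0"
      using has_dir_deriv_local_max(2)[OF Zd(1) Zdd(1), of "1 - dist a m" m]
        has_dir_deriv_local_max(2)[OF Zd(2) Zdd(2), of "1 - dist a m" m] max m(3) False by auto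
    then have "Z11 m + Z22 m \<le> 0" by simp
    also have "Z11 m + Z22 m = 2 * ((\<eta> m * u11 m - 4 * rel_coord 1 a m * u1 m)\<^sup>2 + (\<eta> m * u12 m - 4 * rel_coord 2 a m * u1 m)\<^sup>2
        + (\<eta> m * u12 m - 4 * rel_coord 1 a m * u2 m)\<^sup>2 + (\<eta> m * u22 m - 4 * rel_coord 2 a m * u2 m)\<^sup>2)
      + (2 * lam - 24 * \<rho> - 8 * \<eta> m) * grad_sq m
      + 2 * (\<eta> m * \<eta> m) * (u1 m * (u111 m + u122 m) + u2 m * (u112 m + u222 m))
      + 2 * lam * (u m * (u11 m + u22 m))"
      unfolding Z11_def Z22_def \<rho>_def grad_sq_def by (simp add: power2_eq_square algebra_simps)
    also have "u1 m * (u111 m + u122 m) + u2 m * (u112 m + u222 m) = f' (u m) * grad_sq m"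
      unfolding eq1 eq2 grad_sq_def by (simp add: algebra_simps)
    also have "u11 m + u22 m = f (u m)" by (rule eq)
    finally have "(2 * lam - 24 * \<rho> - 8 * \<eta> m) * grad_sq m
        + 2 * (\<eta> m * \<eta> m) * (f' (u m) * grad_sq m) + 2 * lam * (u m * f (u m)) \<le> 0"
      by (smt (verit) zero_le_power2)
    moreover have "(\<eta> m * \<eta> m) * (f' (u m) * grad_sq m) \<ge> - (L * grad_sq m)"
    proof -
      have "\<bar>(\<eta> m * \<eta> m) * f' (u m)\<bar> \<le> 1 * L"
        unfolding abs_mult[of "\<eta> m * \<eta> m"] using \<rho> bounds(3)[of m] by (intro mult_mono) (auto simp: mult_le_one)
      then have "(- L) * grad_sq m \<le> ((\<eta> m * \<eta> m) * f' (u m)) * grad_sq m"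
        by (intro mult_right_mono) (auto simp: grad_sq_def abs_le_iff)
      then show ?thesis by (simp add: mult.assoc)
    qed
    moreover have "u m * f (u m) \<ge> - (N * F)"
    proof -
      have "\<bar>u m * f (u m)\<bar> \<le> N * F"
        unfolding abs_mult using bounds(1,2)[of m] bounds_nonneg by (intro mult_mono) auto
      then show ?thesis by linarith
    qed
    then have "lam * (u m * f (u m)) \<ge> lam * (- (N * F))"
      using lam by (rule mult_left_mono)
    moreover have "(2 * lam - 24 * \<rho> - 8 * \<eta> m) * grad_sq m \<ge> (2 * lam - 32) * grad_sq m"
      using \<rho> by (intro mult_right_mono) (auto simp: grad_sq_def)
    ultimately have "(2 * lam - 32) * grad_sq m - 2 * (L * grad_sq m) - 2 * (lam * (N * F)) \<le> 0"
      by (simp add: mult.assoc)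
    then have g: "grad_sq m \<le> lam * (N * F)"
      by (simp add: lam_def algebra_simps)
    have "\<eta> m * \<eta> m * grad_sq m \<le> 1 * grad_sq m"
      using \<rho> by (intro mult_right_mono) (auto simp: grad_sq_def mult_le_one)
    moreover have "lam * (u m * u m) \<le> lam * N\<^sup>2"
      using uu lam by (intro mult_left_mono)
    ultimately show ?thesis
      using g unfolding Z_def grad_sq_def[symmetric] by (simp add: distrib_left)
  qed
  moreover have "grad_sq a \<le> Z a"
    using lam by (simp add: Z_def \<eta>_def rel_coord_center grad_sq_def)
  moreover have "Z a \<le> Z m" using m(2) by simp
  ultimately show ?thesis by (simp add: lam_def)
qed

text \<open>Modica's estimate. The function \<open>\<bar>\<nabla>u\<bar>\<^sup>2 / 2 - W(u)\<close> is only a weak subsolution of a linear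
  elliptic equation; adding \<open>\<epsilon> exp (K u)\<close> makes it a strict one wherever it is bounded
  below by \<open>p > 0\<close>, and the penalisation \<open>\<delta>\<^sup>2 \<bar>x - a\<bar>\<^sup>2\<close> forces a maximum to exist.\<close>

lemma modica_estimate: "grad_sq a / 2 \<le> W (u a)"
proof (rule ccontr)
  assume "\<not> grad_sq a / 2 \<le> W (u a)"
  define p where "p = grad_sq a / 2 - W (u a)"
  have p: "p > 0" using \<open>\<not> _\<close> by (simp add: p_def)
  define G where "G = (17 + L) * (N * F + N\<^sup>2)"
  have G: "grad_sq x \<le> G" for x unfolding G_def by (rule gradient_bound)
  have G0: "G \<ge> 0" using bounds_nonneg by (simp add: G_def)
  define K where "K = (F + 1) / p"
  have K: "K > 0" "K * p = F + 1" using p bounds_nonneg by (auto simp: K_def)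
  define \<epsilon> where "\<epsilon> = p / (2 * exp (K * N))"
  have eps: "\<epsilon> > 0" "\<epsilon> * exp (K * N) = p / 2" using p by (auto simp: \<epsilon>_def)
  define E where "E = (\<lambda>x. \<epsilon> * exp (K * u x))"
  have Eb: "0 < E x" "E x \<le> p / 2" "\<epsilon> * exp (- K * N) \<le> E x" for x
  proof -
    have "K * u x \<le> K * N" "- K * N \<le> K * u x"
      using bounds(1)[of x] K(1) mult_left_mono[of "u x" N K] mult_left_mono[of "- N" "u x" K] by auto
    then show "E x \<le> p / 2" "\<epsilon> * exp (- K * N) \<le> E x"
      unfolding eps(2)[symmetric] E_def using eps(1) by (auto intro!: mult_left_mono)
    show "0 < E x" using eps by (simp add: E_def)
  qed
  define c where "c = K * (\<epsilon> * exp (- K * N))"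
  have c: "c > 0" using K eps by (simp add: c_def)
  define C where "C = G / 2 + p / 2"
  define H where "H = F + K * (p / 2)"
  have H0: "H \<ge> 0" using K p bounds_nonneg by (simp add: H_def)
  have C0: "C > 0" using G0 p by (simp add: C_def)
  define D where "D = 4 * G + 2 * H * (C + G)"
  have D0: "D \<ge> 0" using G0 H0 C0 by (simp add: D_def)
  define \<delta> where "\<delta> = min 1 (p * c / (2 * (D + 1)))"
  have \<delta>: "0 < \<delta>" "\<delta> \<le> 1" using p c D0 by (auto simp: \<delta>_def)
  have "\<delta> * D < p * c"
  proof -
    have "\<delta> * D \<le> (p * c / (2 * (D + 1))) * D"
      using D0 by (intro mult_right_mono) (auto simp: \<delta>_def)
    also have "\<dots> = (p * c) * (D / (2 * (D + 1)))" by simp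
    also have "\<dots> < (p * c) * 1"
      using p c D0 by (intro mult_strict_left_mono) (auto simp: divide_less_eq)
    finally show ?thesis by simp
  qed
  define Z where "Z = (\<lambda>x. 1 / 2 * (u1 x * u1 x + u2 x * u2 x) - W (u x) + E x
    - \<delta>\<^sup>2 * (rel_coord 1 a x * rel_coord 1 a x + rel_coord 2 a x * rel_coord 2 a x))"
  define Z1 where "Z1 = (\<lambda>x. (u1 x * u11 x + u2 x * u12 x) - f (u x) * u1 x + K * (E x * u1 x)
    - 2 * \<delta>\<^sup>2 * rel_coord 1 a x)"
  define Z2 where "Z2 = (\<lambda>x. (u1 x * u12 x + u2 x * u22 x) - f (u x) * u2 x + K * (E x * u2 x)
    - 2 * \<delta>\<^sup>2 * rel_coord 2 a x)"
  define Z11 where "Z11 = (\<lambda>x. (u11 x * u11 x + u1 x * u111 x + u12 x * u12 x + u2 x * u112 x)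
    - (f' (u x) * u1 x * u1 x + f (u x) * u11 x) + K * (K * E x * u1 x * u1 x + E x * u11 x) - 2 * \<delta>\<^sup>2)"
  define Z22 where "Z22 = (\<lambda>x. (u12 x * u12 x + u1 x * u122 x + u22 x * u22 x + u2 x * u222 x)
    - (f' (u x) * u2 x * u2 x + f (u x) * u22 x) + K * (K * E x * u2 x * u2 x + E x * u22 x) - 2 * \<delta>\<^sup>2)"
  note Wd = has_dir_deriv_compose_real[OF d(1) dW] has_dir_deriv_compose_real[OF d(2) dW]
    has_dir_deriv_compose_real[OF d(1) df] has_dir_deriv_compose_real[OF d(2) df]
  have exp': "((\<lambda>y. \<epsilon> * exp (K * y)) has_real_derivative K * (\<epsilon> * exp (K * y))) (at y)" for y
    by (auto intro!: derivative_eq_intros)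
  have Ed: "has_dir_deriv E (\<lambda>x. K * E x * u1 x) (axis 1 1)" "has_dir_deriv E (\<lambda>x. K * E x * u2 x) (axis 2 1)"
    unfolding E_def
    using has_dir_deriv_compose_real[OF d(1) exp'] has_dir_deriv_compose_real[OF d(2) exp'] by simp_all
  have Zd: "has_dir_deriv Z Z1 (axis 1 1)" "has_dir_deriv Z Z2 (axis 2 1)"
    unfolding Z_def Z1_def Z2_def
    by (rule has_dir_deriv_cong, (rule has_dir_deriv_intros Wd Ed d rel_coord_deriv)+, simp add: algebra_simps)+
  have Zdd: "has_dir_deriv Z1 Z11 (axis 1 1)" "has_dir_deriv Z2 Z22 (axis 2 1)"
    unfolding Z1_def Z2_def Z11_def Z22_def
    by (rule has_dir_deriv_cong, (rule has_dir_deriv_intros Wd Ed d rel_coord_deriv)+, simp add: algebra_simps)+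
  have contW: "continuous_on UNIV (\<lambda>x. W (u x))"
  proof (rule continuous_on_compose2[OF _ cont(1)])
    show "continuous_on UNIV W"
      by (rule DERIV_continuous_on) (rule dW)
  qed simp
  have contZ: "continuous_on UNIV Z"
    unfolding Z_def E_def by (intro continuous_intros cont contW rel_coord_cont)
  define R where "R = (C + 1) / \<delta>\<^sup>2 + 1"
  have R: "R > 0" "\<delta>\<^sup>2 * R\<^sup>2 > C"
  proof -
    have "R \<ge> 1" using C0 by (simp add: R_def)
    then show "R > 0" by simp
    have "\<delta>\<^sup>2 * R = C + 1 + \<delta>\<^sup>2" using \<delta> by (simp add: R_def field_simps)
    then have "C < \<delta>\<^sup>2 * R" using zero_le_power2[of \<delta>] by linarith
    also have "\<dots> \<le> \<delta>\<^sup>2 * R\<^sup>2"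
      using \<open>R \<ge> 1\<close> by (intro mult_left_mono) (auto simp: power2_eq_square)
    finally show "\<delta>\<^sup>2 * R\<^sup>2 > C" .
  qed
  obtain m where m: "m \<in> cball a R" "\<And>y. y \<in> cball a R \<Longrightarrow> Z y \<le> Z m"
    "dist a m \<noteq> R \<Longrightarrow> ball m (R - dist a m) \<subseteq> cball a R \<and> R - dist a m > 0"
    using cball_interior_max[OF R(1) contZ, of a] by metis
  define \<rho> where "\<rho> = rel_coord 1 a m * rel_coord 1 a m + rel_coord 2 a m * rel_coord 2 a m"
  have Zm: "Z m = grad_sq m / 2 - W (u m) + E m - \<delta>\<^sup>2 * \<rho>"
    by (simp add: Z_def grad_sq_def \<rho>_def)
  have "p \<le> Z a"
    using Eb(1)[of a] by (simp add: Z_def rel_coord_center p_def grad_sq_def)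
  also have "Z a \<le> Z m" using m(2) R(1) by simp
  finally have pZ: "p \<le> Z m" .
  have \<rho>: "\<rho> \<ge> 0" "\<delta>\<^sup>2 * \<rho> \<le> C"
    using Zm pZ p G[of m] Eb(2)[of m] W_nonneg[of "u m"] by (auto simp: \<rho>_def C_def)
  have interior: "dist a m \<noteq> R"
    using R(2) \<rho>(2) by (auto simp: \<rho>_def rel_coord_sq)
  have gp: "grad_sq m \<ge> p"
    using Zm pZ Eb(2)[of m] W_nonneg[of "u m"] mult_nonneg_nonneg[OF zero_le_power2[of \<delta>] \<rho>(1)]
    by linarith
  have max: "Z y \<le> Z m" if "y \<in> ball m (R - dist a m)" for y
    using m(2,3) interior that by blast
  note crit = has_dir_deriv_local_max[OF Zd(1) Zdd(1), of "R - dist a m" m]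
    has_dir_deriv_local_max[OF Zd(2) Zdd(2), of "R - dist a m" m]
  have "Z1 m = 0" "Z11 m \<le> 0" "Z2 m = 0" "Z22 m \<le> 0"
    using crit max m(3) interior by auto
  define h where "h = K * E m"
  define s where "s = f (u m) - h"
  define v1 where "v1 = u1 m * u11 m + u2 m * u12 m"
  define v2 where "v2 = u1 m * u12 m + u2 m * u22 m"
  have v: "v1 = s * u1 m + 2 * \<delta>\<^sup>2 * rel_coord 1 a m" "v2 = s * u2 m + 2 * \<delta>\<^sup>2 * rel_coord 2 a m"
    using \<open>Z1 m = 0\<close> \<open>Z2 m = 0\<close> by (auto simp: Z1_def Z2_def v1_def v2_def s_def h_def algebra_simps)
  define Y where "Y = rel_coord 1 a m * u1 m + rel_coord 2 a m * u2 m"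
  have "Z11 m + Z22 m \<le> 0" using \<open>Z11 m \<le> 0\<close> \<open>Z22 m \<le> 0\<close> by simp
  also have "Z11 m + Z22 m = hess_sq m + (u1 m * (u111 m + u122 m) + u2 m * (u112 m + u222 m))
      - f' (u m) * grad_sq m - (f (u m) - h) * (u11 m + u22 m) + K * h * grad_sq m - 4 * \<delta>\<^sup>2"
    unfolding Z11_def Z22_def hess_sq_def grad_sq_def h_def by (simp add: algebra_simps)
  also have "u1 m * (u111 m + u122 m) + u2 m * (u112 m + u222 m) = f' (u m) * grad_sq m"
    unfolding eq1 eq2 grad_sq_def by (simp add: algebra_simps)
  also have "u11 m + u22 m = f (u m)" by (rule eq)
  finally have lap: "hess_sq m \<le> s * f (u m) - K * h * grad_sq m + 4 * \<delta>\<^sup>2"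
    by (simp add: s_def)
  have "v1\<^sup>2 + v2\<^sup>2 + ((u1 m * u12 m - u2 m * u11 m)\<^sup>2 + (u1 m * u22 m - u2 m * u12 m)\<^sup>2) = hess_sq m * grad_sq m"
    by (simp add: v1_def v2_def hess_sq_def grad_sq_def power2_eq_square algebra_simps)
  then have v_le: "v1\<^sup>2 + v2\<^sup>2 \<le> hess_sq m * grad_sq m"
    by (smt (verit) zero_le_power2)
  have "v1\<^sup>2 + v2\<^sup>2 = s\<^sup>2 * grad_sq m + 4 * s * (\<delta>\<^sup>2 * Y) + 4 * (\<delta>\<^sup>2)\<^sup>2 * \<rho>"
    unfolding v by (simp add: Y_def \<rho>_def grad_sq_def power2_eq_square algebra_simps)
  then have "s\<^sup>2 * grad_sq m + 4 * s * (\<delta>\<^sup>2 * Y) \<le> v1\<^sup>2 + v2\<^sup>2"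
    using \<rho>(1) by simp
  also note v_le
  also have "hess_sq m * grad_sq m \<le> (s * f (u m) - K * h * grad_sq m + 4 * \<delta>\<^sup>2) * grad_sq m"
    using lap gp p by (intro mult_right_mono) auto
  finally have main: "(s\<^sup>2 - s * f (u m) + K * h * grad_sq m) * grad_sq m
      \<le> 4 * \<delta>\<^sup>2 * grad_sq m - 4 * (s * (\<delta>\<^sup>2 * Y))"
    by (simp add: algebra_simps)
  have h: "h > 0" "c \<le> h" "h \<le> K * (p / 2)"
    using Eb[of m] K(1) by (auto simp: h_def c_def)
  have "s\<^sup>2 - s * f (u m) + K * h * grad_sq m = h\<^sup>2 + h * (K * grad_sq m - f (u m))"
    by (simp add: s_def power2_eq_square algebra_simps)
  moreover have "K * grad_sq m - f (u m) \<ge> 1"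
    using mult_left_mono[OF gp, of K] K bounds(2)[of m] by auto
  then have "h * (K * grad_sq m - f (u m)) \<ge> h * 1"
    using h(1) by (intro mult_left_mono) auto
  ultimately have "c \<le> s\<^sup>2 - s * f (u m) + K * h * grad_sq m"
    using h by (smt (verit) zero_le_power2)
  then have "p * c \<le> (s\<^sup>2 - s * f (u m) + K * h * grad_sq m) * grad_sq m"
    using gp p c by (subst mult.commute) (intro mult_mono, auto)
  also note main
  also have "4 * \<delta>\<^sup>2 * grad_sq m - 4 * (s * (\<delta>\<^sup>2 * Y)) \<le> \<delta> * D"
  proof -
    have "\<delta>\<^sup>2 * grad_sq m \<le> \<delta> * G"
      using \<delta> G[of m] gp p by (intro mult_mono) (auto simp: power2_eq_square mult_left_le)
    moreover have "\<bar>s * (\<delta>\<^sup>2 * Y)\<bar> \<le> H * (\<delta> * (C + G) / 2)"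
    proof -
      have *: "2 * \<bar>\<delta> * (x * y)\<bar> \<le> \<delta>\<^sup>2 * (x * x) + y * y" for x y :: real
      proof -
        have "(\<delta> * x - y)\<^sup>2 \<ge> 0" "(\<delta> * x + y)\<^sup>2 \<ge> 0" by simp_all
        then show ?thesis by (simp add: power2_eq_square algebra_simps abs_if)
      qed
      have "2 * \<bar>\<delta> * Y\<bar> \<le> 2 * \<bar>\<delta> * (rel_coord 1 a m * u1 m)\<bar> + 2 * \<bar>\<delta> * (rel_coord 2 a m * u2 m)\<bar>"
        using abs_triangle_ineq[of "\<delta> * (rel_coord 1 a m * u1 m)" "\<delta> * (rel_coord 2 a m * u2 m)"]
        by (simp add: Y_def distrib_left)
      also have "\<dots> \<le> \<delta>\<^sup>2 * \<rho> + grad_sq m"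
        using *[of "rel_coord 1 a m" "u1 m"] *[of "rel_coord 2 a m" "u2 m"] by (simp add: \<rho>_def grad_sq_def distrib_left)
      also have "\<dots> \<le> C + G" using \<rho>(2) G[of m] by simp
      finally have "\<bar>\<delta> * Y\<bar> \<le> (C + G) / 2" by simp
      then have "\<delta> * \<bar>\<delta> * Y\<bar> \<le> \<delta> * ((C + G) / 2)" using \<delta> by (intro mult_left_mono) auto
      moreover have "\<bar>\<delta>\<^sup>2 * Y\<bar> = \<delta> * \<bar>\<delta> * Y\<bar>"
        using \<delta> by (simp add: abs_mult power2_eq_square)
      moreover have "\<bar>s\<bar> \<le> H"
        using bounds(2)[of m] h by (auto simp: s_def H_def)
      ultimately show ?thesis
        unfolding abs_mult[of s] using H0 by (intro mult_mono) auto
    qed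
    ultimately show ?thesis by (simp add: D_def algebra_simps)
  qed
  finally show False using \<open>\<delta> * D < p * c\<close> by simp
qed

end

lemma bounded_continuous_compose:
  fixes g :: "real \<Rightarrow> real" and u :: "'a \<Rightarrow> real"
  assumes "continuous_on UNIV g" "\<And>x. \<bar>u x\<bar> \<le> N"
  shows "\<exists>B. \<forall>x. \<bar>g (u x)\<bar> \<le> B"
proof -
  have "compact (g ` {-N..N})"
    using assms(1) by (intro compact_continuous_image) (auto intro: continuous_on_subset)
  then obtain B where B: "\<And>y. y \<in> {-N..N} \<Longrightarrow> \<bar>g y\<bar> \<le> B"
    using compact_imp_bounded by (fastforce simp: bounded_iff)
  have "u x \<in> {-N..N}" for x using assms(2)[of x] by (auto simp: abs_le_iff)
  then show ?thesis using B by blast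
qed

lemma Ck_real_deriv:
  fixes W :: "real \<Rightarrow> real"
  assumes "Ck (Suc k) W"
  shows "(W has_real_derivative deriv W y) (at y)" "Ck k (deriv W)"
proof -
  have *: "(W has_real_derivative partial_deriv 1 W y) (at y)" for y
    using has_dir_deriv_line_real[OF Ck_has_dir_deriv[OF assms], of 0 1 y] by simp
  then have "partial_deriv 1 W = deriv W"
    by (metis DERIV_imp_deriv ext)
  then show "(W has_real_derivative deriv W y) (at y)" "Ck k (deriv W)"
    using * Ck_partial_deriv[OF assms, of 1] by simp_all
qed

lemma bounded_solution_gradient_estimate:
  fixes W :: "real \<Rightarrow> real" and u :: "real^2 \<Rightarrow> real"
  assumes W: "Ck 2 W" "\<And>p. W p \<ge> 0" and u: "Ck 3 u" "bounded (range u)"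
    and eq: "\<And>x. laplacian u x = deriv W (u x)"
  shows "((partial_1 u x)\<^sup>2 + (partial_2 u x)\<^sup>2) / 2 \<le> W (u x)"
proof -
  have C3: "Ck (Suc (Suc (Suc 0))) u" using u(1) by (simp add: numeral_3_eq_3)
  have W2: "Ck (Suc (Suc 0)) W" using W(1) by (simp add: numeral_2_eq_2)
  note W1 = Ck_real_deriv[OF W2]
  note W0 = Ck_real_deriv[OF W1(2)]
  obtain N where N: "\<And>x. \<bar>u x\<bar> \<le> N"
    using u(2) by (auto simp: bounded_iff)
  obtain F where F: "\<And>x. \<bar>deriv W (u x)\<bar> \<le> F"
    using bounded_continuous_compose[OF Ck_imp_continuous[OF W1(2)], of u N] N by blast
  obtain L where L: "\<And>x. \<bar>deriv (deriv W) (u x)\<bar> \<le> L"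
    using bounded_continuous_compose[OF Ck_imp_continuous[OF W0(2)], of u N] N by blast
  note C2 = Ck_partial_deriv[OF C3 axis_Basis]
  note C1 = Ck_partial_deriv[OF C2 axis_Basis]
  have sym2: "partial_1 (partial_2 u) = partial_2 (partial_1 u)"
    using Ck_mixed_partials[OF C3 axis_Basis axis_Basis] by blast
  have sym3: "partial_1 (partial_2 v) = partial_2 (partial_1 v)" if "Ck (Suc (Suc 0)) v" for v :: "real^2 \<Rightarrow> real"
    using Ck_mixed_partials[OF that axis_Basis axis_Basis] by blast
  have eq': "partial_1 (partial_1 u) x + partial_2 (partial_2 u) x = deriv W (u x)" for x
    using eq[of x] by (simp add: laplacian_real_2)
  have diff_eq: "partial_deriv e (partial_1 (partial_1 u)) x + partial_deriv e (partial_2 (partial_2 u)) x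
      = deriv (deriv W) (u x) * partial_deriv e u x" for e x
  proof -
    have "has_dir_deriv (\<lambda>x. partial_1 (partial_1 u) x + partial_2 (partial_2 u) x)
        (\<lambda>x. partial_deriv e (partial_1 (partial_1 u)) x + partial_deriv e (partial_2 (partial_2 u)) x) e"
      by (intro has_dir_deriv_add Ck_has_dir_deriv[OF C1])
    moreover have "has_dir_deriv (\<lambda>x. deriv W (u x)) (\<lambda>x. deriv (deriv W) (u x) * partial_deriv e u x) e"
      by (rule has_dir_deriv_compose_real[OF Ck_has_dir_deriv[OF C3] W0(1)])
    ultimately show ?thesis
      unfolding eq' has_dir_deriv_def using vector_derivative_unique_at by blast
  qed
  interpret planar_scalar_solution u "partial_1 u" "partial_2 u" "partial_1 (partial_1 u)"
    "partial_2 (partial_1 u)" "partial_2 (partial_2 u)" "partial_1 (partial_1 (partial_1 u))"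
    "partial_1 (partial_2 (partial_1 u))" "partial_2 (partial_2 (partial_1 u))"
    "partial_2 (partial_2 (partial_2 u))" W "deriv W" "deriv (deriv W)" N F L
  proof
    show "has_dir_deriv (partial_2 u) (partial_2 (partial_1 u)) (axis 1 1)"
      using Ck_has_dir_deriv[OF C2] by (simp add: sym2[symmetric])
    show "partial_1 (partial_1 (partial_1 u)) x + partial_2 (partial_2 (partial_1 u)) x
        = deriv (deriv W) (u x) * partial_1 u x" for x
      using diff_eq[of "axis 1 1" x] sym3[OF C2] sym2 by metis
    show "partial_1 (partial_2 (partial_1 u)) x + partial_2 (partial_2 (partial_2 u)) x
        = deriv (deriv W) (u x) * partial_2 u x" for x
      using diff_eq[of "axis 2 1" x] sym3[OF C2] by metis
  qed (fact Ck_has_dir_deriv[OF C3] Ck_has_dir_deriv[OF C2] Ck_has_dir_deriv[OF C1]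
      Ck_imp_continuous[OF C3] Ck_imp_continuous[OF C2] W1(1) W0(1) eq' W(2) N F L)+
  show ?thesis
    using modica_estimate[of x] by (simp add: grad_sq_def power2_eq_square)
qed

theorem theorem4p5:
  shows "(\<forall>(W :: real^'m \<Rightarrow> real) (u :: real^2 \<Rightarrow> real^'m).
            Ck 2 W \<and> (\<forall>p. W p \<ge> 0) \<and> Ck 2 u \<and>
            (\<forall>x. GDERIV W (u x) :> laplacian u x) \<and>
            (\<forall>x. ((norm (partial_1 u x))\<^sup>2 - (norm (partial_2 u x))\<^sup>2)\<^sup>2
                  + 4 * (partial_1 u x \<bullet> partial_2 u x)\<^sup>2 \<le> 4 * (W (u x))\<^sup>2) \<longrightarrow>
            (\<forall>x. mono_on {0<..} (\<lambda>r. (1 / r) * (LINT y:ball x r|lborel. W (u y)))))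
       \<and> (\<forall>(W :: real \<Rightarrow> real) (u :: real^2 \<Rightarrow> real).
            Ck 2 W \<and> (\<forall>p. W p \<ge> 0) \<and> Ck 3 u \<and> bounded (range u) \<and>
            (\<forall>x. laplacian u x = deriv W (u x)) \<longrightarrow>
            (\<forall>x. mono_on {0<..} (\<lambda>r. (1 / r) * (LINT y:ball x r|lborel. W (u y)))))"
proof (intro conjI allI impI; elim conjE)
  fix W :: "real^'m \<Rightarrow> real" and u :: "real^2 \<Rightarrow> real^'m" and x
  assume "\<forall>p. W p \<ge> 0" "Ck 2 u" "\<forall>x. GDERIV W (u x) :> laplacian u x"
    "\<forall>x. ((norm (partial_1 u x))\<^sup>2 - (norm (partial_2 u x))\<^sup>2)\<^sup>2
      + 4 * (partial_1 u x \<bullet> partial_2 u x)\<^sup>2 \<le> 4 * (W (u x))\<^sup>2"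
  then show "mono_on {0<..} (\<lambda>r. (1 / r) * (LINT y:ball x r|lborel. W (u y)))"
    by (intro stress_tensor_monotonicity) auto
next
  fix W :: "real \<Rightarrow> real" and u :: "real^2 \<Rightarrow> real" and x
  assume *: "Ck 2 W" "\<forall>p. W p \<ge> 0" "Ck 3 u" "bounded (range u)" "\<forall>x. laplacian u x = deriv W (u x)"
  have W': "(W has_real_derivative deriv W y) (at y)" for y
    using Ck_real_deriv(1)[of 1 W y] *(1) by (simp add: numeral_2_eq_2)
  show "mono_on {0<..} (\<lambda>r. (1 / r) * (LINT y:ball x r|lborel. W (u y)))"
  proof (rule stress_tensor_monotonicity[where W = W and u = u])
    show "W p \<ge> 0" for p using * by blast
    show "Ck 2 u" using *(3) Ck_Suc_imp[of 2 u] by (simp add: numeral_3_eq_3 numeral_2_eq_2)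
    show "GDERIV W (u y) :> laplacian u y" for y using * W' by simp
    show "((norm (partial_1 u y))\<^sup>2 - (norm (partial_2 u y))\<^sup>2)\<^sup>2
      + 4 * (partial_1 u y \<bullet> partial_2 u y)\<^sup>2 \<le> 4 * (W (u y))\<^sup>2" for y
    proof -
      have "(partial_1 u y)\<^sup>2 + (partial_2 u y)\<^sup>2 \<le> 2 * W (u y)"
        using bounded_solution_gradient_estimate[of W u y] * by simp
      then have "((partial_1 u y)\<^sup>2 + (partial_2 u y)\<^sup>2)\<^sup>2 \<le> (2 * W (u y))\<^sup>2"
        by (rule power_mono) simp
      then show ?thesis
        by (simp add: power2_eq_square algebra_simps)
    qed
  qed
qed

end
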